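(* Let $p>3$ be a prime. Then $$\sum_{k=0}^{(p-1)/2}\frac{\binom{2k}{k}\binom{3k}{k}}{27^k}\equiv\left(\frac p3\right)\frac{2^p+1}{3}\pmod{p^2},$$ $$\sum_{k=0}^{(p-1)/2}\frac{\binom{6k}{3k}\binom{3k}{k}}{(2k+1)432^k}\equiv\left(\frac p3\right)\frac{3^p+1}{4}\pmod{p^2},$$ $$\sum_{k=0}^{(p-1)/2}\frac{\binom{4k}{2k}\binom{2k}{k}}{(2k+1)64^k}\equiv\left(\frac{-1}{p}\right)2^{p-1}\pmod{p^2}.$$
   Context: $\left(\frac{\cdot}{p}\right)$ and $\left(\frac{p}{3}\right)$ denote Legendre symbols. For rational numbers $x,y$ whose denominators are prime to $p$, $x\equiv y\pmod{p^m}$ means that $x-y$ is $p^m$ times a rational number with denominator prime to $p$. *)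

theory Defs
  imports Complex_Main "HOL-Number_Theory.Number_Theory"
begin

definition p_integral :: "nat \<Rightarrow> rat \<Rightarrow> bool" where
  "p_integral p x \<longleftrightarrow> coprime (snd (quotient_of x)) (int p)"

(* Congruence is meaningful only between p-integral rationals, so integrality of both
   sides is part of the relation. *)
definition rat_cong :: "nat \<Rightarrow> nat \<Rightarrow> rat \<Rightarrow> rat \<Rightarrow> bool" where
  "rat_cong p m x y \<longleftrightarrow> p_integral p x \<and> p_integral p y \<and>
     (\<exists>z. p_integral p z \<and> x - y = of_nat p ^ m * z)"

end

theory Submission
  imports Defs
begin

text \<open>
  The summands are \<open>b\<^sub>k(a)\<close> or \<open>b\<^sub>k(a) / (2k + 1)\<close> with \<open>b\<^sub>k(x) = C(x, k) C(- 1 - x, k)\<close> at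
  \<open>a = - 1/3, - 1/6, - 1/4\<close>. Put \<open>n = (p - 1) / 2\<close> and \<open>G(x) = \<Prod>\<^sub>i\<^sub>\<le>\<^sub>n (1 - x\<^sup>2 / i\<^sup>2)\<close>. The sums \<open>S(x)\<close> of
  \<open>b\<^sub>k(x)\<close> and \<open>T(x)\<close> of \<open>b\<^sub>k(x) / (2k + 1)\<close> over \<open>k \<le> n\<close> satisfy \<open>S(x) + S(x - 1) = 2 G(x)\<close> and
  \<open>(2x + 1) T(x) - (2x - 1) T(x - 1) = 2 G(x)\<close>. Since \<open>b\<^sub>k(x) = b\<^sub>k(- 1 - x)\<close>, we may write the argument as
  \<open>m + p t\<close> with \<open>m = \<lfloor>p / d\<rfloor>\<close>, \<open>t = - 1 / d\<close> and \<open>d = 3, 6, 4\<close>. Now \<open>G(j + p t) \<equiv> p t / j\<close> modulo \<open>p\<^sup>2\<close>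
  for \<open>0 < j \<le> n\<close>, so unrolling the recurrences down to \<open>p t\<close> expresses the sums by harmonic numbers
  \<open>H\<^bsub>\<lfloor>p/d\<rfloor>\<^esub>\<close> modulo \<open>p\<close>, and Lerch's formula turns these into Fermat quotients of 2 and 3.
\<close>

section \<open>Congruences between \<open>p\<close>-integral rationals\<close>

text \<open>Frees the notion from lowest terms: the reduced denominator divides that of any other
  representation. The closure rules below can therefore simply multiply denominators.\<close>

lemma p_integral_iff:
  "p_integral p x \<longleftrightarrow> (\<exists>a b. coprime b (int p) \<and> b \<noteq> 0 \<and> x = of_int a / of_int b)"
proof
  assume "p_integral p x"
  then show "\<exists>a b. coprime b (int p) \<and> b \<noteq> 0 \<and> x = of_int a / of_int b"
    unfolding p_integral_def using quotient_of_div[of x] quotient_of_denom_pos'[of x]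
    by (metis less_irrefl prod.collapse)
next
  assume "\<exists>a b. coprime b (int p) \<and> b \<noteq> 0 \<and> x = of_int a / of_int b"
  then obtain a b where ab: "coprime b (int p)" "b \<noteq> 0" "x = of_int a / of_int b" by blast
  obtain c d where q: "quotient_of x = (c, d)" by fastforce
  have cd: "coprime c d" "d > 0" "x = of_int c / of_int d"
    using q quotient_of_coprime quotient_of_denom_pos quotient_of_div by blast+
  have "(of_int (c * b) :: rat) = of_int (a * d)"
    using ab cd by (simp add: field_simps)
  then have "c * b = a * d" using of_int_eq_iff by blast
  then have "d dvd b"
    using cd(1) by (metis coprime_commute coprime_dvd_mult_right_iff dvd_triv_right)
  then show "p_integral p x"
    using ab(1) q coprime_divisors[of d b "int p" "int p"] by (simp add: p_integral_def)
qed

lemma p_integral_of_int [simp, intro]: "p_integral p (of_int a)"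
  unfolding p_integral_iff by (rule exI[of _ a], rule exI[of _ 1]) simp

lemma p_integral_of_nat [simp, intro]: "p_integral p (of_nat a)"
  using p_integral_of_int[of p "int a"] by simp

lemma p_integral_numeral [simp, intro]: "p_integral p (numeral a)"
  using p_integral_of_nat[of p "numeral a"] by simp

lemma p_integral_0 [simp, intro]: "p_integral p 0"
  using p_integral_of_nat[of p 0] by simp

lemma p_integral_1 [simp, intro]: "p_integral p 1"
  using p_integral_of_nat[of p 1] by simp

lemma p_integral_add [intro!]:
  assumes "p_integral p x" "p_integral p y" shows "p_integral p (x + y)"
proof -
  obtain a b c d where "coprime b (int p)" "b \<noteq> 0" "x = of_int a / of_int b"
    "coprime d (int p)" "d \<noteq> 0" "y = of_int c / of_int d"
    using assms unfolding p_integral_iff by blast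
  then have "coprime (b * d) (int p)" "b * d \<noteq> 0" "x + y = of_int (a * d + c * b) / of_int (b * d)"
    by (auto simp: field_simps)
  then show ?thesis unfolding p_integral_iff by blast
qed

lemma p_integral_mult [intro!]:
  assumes "p_integral p x" "p_integral p y" shows "p_integral p (x * y)"
proof -
  obtain a b c d where "coprime b (int p)" "b \<noteq> 0" "x = of_int a / of_int b"
    "coprime d (int p)" "d \<noteq> 0" "y = of_int c / of_int d"
    using assms unfolding p_integral_iff by blast
  then have "coprime (b * d) (int p)" "b * d \<noteq> 0" "x * y = of_int (a * c) / of_int (b * d)"
    by (auto simp: field_simps)
  then show ?thesis unfolding p_integral_iff by blast
qed

lemma p_integral_minus [intro!]: "p_integral p x \<Longrightarrow> p_integral p (- x)"
  using p_integral_mult[OF p_integral_of_int[of p "- 1"], of x] by simp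

lemma p_integral_diff [intro!]: "p_integral p x \<Longrightarrow> p_integral p y \<Longrightarrow> p_integral p (x - y)"
  using p_integral_add[of p x "- y"] by auto

lemma p_integral_power [intro!]: "p_integral p x \<Longrightarrow> p_integral p (x ^ k)"
  by (induction k) auto

lemma p_integral_sum [intro!]: "(\<And>i. i \<in> A \<Longrightarrow> p_integral p (f i)) \<Longrightarrow> p_integral p (sum f A)"
  by (induction A rule: infinite_finite_induct) auto

lemma p_integral_prod [intro!]: "(\<And>i. i \<in> A \<Longrightarrow> p_integral p (f i)) \<Longrightarrow> p_integral p (prod f A)"
  by (induction A rule: infinite_finite_induct) auto

lemma p_integral_divide:
  assumes "p_integral p x" "coprime k p" "k > 0"
  shows "p_integral p (x / of_nat k)"
proof -
  have "p_integral p (1 / of_nat k)"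
    unfolding p_integral_iff using assms(2,3)
    by (intro exI[of _ 1] exI[of _ "int k"]) auto
  from p_integral_mult[OF assms(1) this] show ?thesis by simp
qed

section \<open>Calculus of the congruence relation\<close>

lemma rat_congI:
  "p_integral p y \<Longrightarrow> p_integral p z \<Longrightarrow> x = y + of_nat p ^ m * z \<Longrightarrow> rat_cong p m x y"
  unfolding rat_cong_def by (auto intro!: p_integral_add p_integral_mult p_integral_power)

lemma rat_congE:
  assumes "rat_cong p m x y"
  obtains z where "p_integral p z" "x = y + of_nat p ^ m * z" "p_integral p x" "p_integral p y"
  using assms unfolding rat_cong_def by (auto simp: algebra_simps)

lemma rat_cong_refl [intro]: "p_integral p x \<Longrightarrow> rat_cong p m x x"
  by (rule rat_congI[of p x 0]) auto

lemma rat_cong_sym: "rat_cong p m x y \<Longrightarrow> rat_cong p m y x"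
  by (erule rat_congE, rule rat_congI[where z = "- z" for z]) auto

lemma rat_cong_trans [trans]: "rat_cong p m x y \<Longrightarrow> rat_cong p m y w \<Longrightarrow> rat_cong p m x w"
  by (elim rat_congE, rule rat_congI[where z = "z + z'" for z z']) (auto simp: algebra_simps)

lemma rat_cong_add [intro]:
  "rat_cong p m x y \<Longrightarrow> rat_cong p m x' y' \<Longrightarrow> rat_cong p m (x + x') (y + y')"
  by (elim rat_congE, rule rat_congI[where z = "z + z'" for z z']) (auto simp: algebra_simps)

lemma rat_cong_mult [intro]:
  assumes "rat_cong p m x y" "rat_cong p m x' y'" shows "rat_cong p m (x * x') (y * y')"
proof -
  obtain z where z: "p_integral p z" "x = y + of_nat p ^ m * z" "p_integral p x" "p_integral p y"
    using assms(1) by (rule rat_congE)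
  obtain z' where z': "p_integral p z'" "x' = y' + of_nat p ^ m * z'" "p_integral p x'" "p_integral p y'"
    using assms(2) by (rule rat_congE)
  show ?thesis
    by (rule rat_congI[where z = "y * z' + z * y' + of_nat p ^ m * z * z'"])
      (use z z' in \<open>auto simp: algebra_simps\<close>)
qed

lemma rat_cong_cmult: "rat_cong p m x y \<Longrightarrow> p_integral p c \<Longrightarrow> rat_cong p m (c * x) (c * y)"
  by blast

lemma rat_cong_minus: "rat_cong p m x y \<Longrightarrow> rat_cong p m (- x) (- y)"
  by (erule rat_congE, rule rat_congI[where z = "- z" for z]) auto

lemma rat_cong_diff [intro]:
  "rat_cong p m x y \<Longrightarrow> rat_cong p m x' y' \<Longrightarrow> rat_cong p m (x - x') (y - y')"
  using rat_cong_add[OF _ rat_cong_minus, of p m x y x' y'] by simp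

lemma rat_cong_sum [intro]:
  "(\<And>i. i \<in> A \<Longrightarrow> rat_cong p m (f i) (g i)) \<Longrightarrow> rat_cong p m (sum f A) (sum g A)"
  by (induction A rule: infinite_finite_induct) auto

lemma rat_cong_lift: "rat_cong p 1 x y \<Longrightarrow> rat_cong p 2 (of_nat p * x) (of_nat p * y)"
  by (elim rat_congE, rule rat_congI[where z = z for z]) (auto simp: algebra_simps power2_eq_square)

text \<open>On expansion, every product of two or more terms p c_i is divisible by p^2.\<close>

lemma rat_cong_prod_1_plus:
  assumes "\<And>i. i \<in> A \<Longrightarrow> p_integral p (c i)"
  shows "rat_cong p 2 (\<Prod>i\<in>A. 1 + of_nat p * c i) (1 + of_nat p * (\<Sum>i\<in>A. c i))"
  using assms
proof (induction A rule: infinite_finite_induct)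
  case (insert i A)
  have "rat_cong p 2 ((1 + of_nat p * c i) * (\<Prod>i\<in>A. 1 + of_nat p * c i))
     ((1 + of_nat p * c i) * (1 + of_nat p * (\<Sum>i\<in>A. c i)))"
    using insert by (intro rat_cong_cmult insert.IH) auto
  also have "rat_cong p 2 \<dots> (1 + of_nat p * (c i + (\<Sum>i\<in>A. c i)))"
    by (rule rat_congI[where z = "c i * (\<Sum>i\<in>A. c i)"])
      (use insert in \<open>auto simp: algebra_simps power2_eq_square\<close>)
  finally show ?case using insert by simp
qed auto

text \<open>The factor c + p s is a unit, and since the right-hand side already carries a factor p,
  replacing c + p s by c changes the quotient only by a multiple of p^2.\<close>

lemma rat_cong_unit_cancel:
  assumes "rat_cong p 2 ((of_nat c + of_nat p * s) * y) (of_nat p * u)"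
    "coprime c p" "c > 0" "p_integral p s" "p_integral p y" "p_integral p u"
  shows "rat_cong p 2 y (of_nat p * u / of_nat c)"
proof -
  from assms(1) obtain z where z: "p_integral p z"
    "(of_nat c + of_nat p * s) * y = of_nat p * u + of_nat p ^ 2 * z" by (rule rat_congE)
  \<comment> \<open>Solving the equation for y, with the term p s y moved to the right, gives y = p
    w. Substituting this back into p s y then yields the sharper error term.\<close>
  define w where "w = (u + of_nat p * z - s * y) / of_nat c"
  have w: "p_integral p w" unfolding w_def using assms z by (intro p_integral_divide) auto
  have yw: "y = of_nat p * w"
    unfolding w_def using z(2) assms(3) by (simp add: field_simps power2_eq_square)
  have *: "p_integral p ((z - s * w) / of_nat c)" using assms z w by (intro p_integral_divide) auto
  have "y = of_nat p * u / of_nat c + of_nat p ^ 2 * ((z - s * w) / of_nat c)"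
    using z(2) assms(3) unfolding yw by (simp add: field_simps power2_eq_square)
  with * assms show ?thesis by (intro rat_congI p_integral_divide p_integral_mult) auto
qed

section \<open>Harmonic numbers and Fermat quotients\<close>

definition harmonic :: "nat \<Rightarrow> rat" where
  "harmonic m = (\<Sum>i=1..m. 1 / of_nat i)"

lemma harmonic_0 [simp]: "harmonic 0 = 0"
  by (simp add: harmonic_def)

lemma harmonic_Suc: "harmonic (Suc m) = harmonic m + 1 / of_nat (Suc m)"
  by (simp add: harmonic_def)

text \<open>Adding \<open>harmonic m\<close> doubles the even terms and removes the odd ones,
  leaving the sum of 2 / (2 i) over i \<le> m div 2.\<close>

lemma alternating_harmonic_sum:
  "(\<Sum>j=1..m. (- 1) ^ j / of_nat j) = harmonic (m div 2) - harmonic m"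
proof (induction m)
  case (Suc m)
  show ?case
  proof (cases "even m")
    case True
    then show ?thesis using Suc by (simp add: harmonic_Suc)
  next
    case False
    then obtain k where k: "m = 2 * k + 1" by (auto elim: oddE)
    have "Suc m div 2 = Suc k" "m div 2 = k" using k by auto
    moreover have "(1 :: rat) / of_nat (Suc k) = 2 / of_nat (Suc m)"
      unfolding k by (simp add: field_simps)
    ultimately show ?thesis using Suc False by (simp add: harmonic_Suc)
  qed
qed simp

text \<open>Partial fractions: 1 / (k (2 k + 1)) = 1 / k - 2 / (2 k + 1). The range stops before n
  because in the application 2 n + 1 = p.\<close>

lemma sum_inverse_mult_odd:
  assumes "n > 0"
  shows "(\<Sum>k=1..<n. 1 / (of_nat k * of_nat (2 * k + 1))) =
    2 * harmonic n - 2 * harmonic (2 * n) + 2 - 1 / of_nat n"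
  using assms
proof (induction n rule: nat_induct_non_zero)
  case 1
  show ?case by (simp add: harmonic_def numeral_2_eq_2)
next
  case (Suc n)
  have "2 * Suc n = Suc (Suc (2 * n))" by simp
  then have h: "harmonic (2 * Suc n) = harmonic (2 * n) + 1 / of_nat (2 * n + 1) + 1 / of_nat (2 * n + 2)"
    by (simp only: harmonic_Suc) simp
  have s: "(\<Sum>k=1..<Suc n. 1 / (of_nat k * of_nat (2 * k + 1))) =
     (\<Sum>k=1..<n. 1 / (of_nat k * of_nat (2 * k + 1))) + 1 / (of_nat n * of_nat (2 * n + 1) :: rat)"
    using Suc by simp
  have e: "1 / (of_nat n * of_nat (2 * n + 1) :: rat) = 1 / of_nat n - 2 / of_nat (2 * n + 1)"
    using Suc by (simp add: field_simps)
  have f: "(2 :: rat) / of_nat (2 * n + 2) = 1 / of_nat (Suc n)"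
    by (simp add: field_simps)
  show ?case unfolding s h Suc.IH harmonic_Suc e using f by (simp add: algebra_simps)
qed

section \<open>Fermat quotients, harmonic numbers modulo p and Lerch's formula\<close>

lemma prod_mult_mod_prime:
  fixes a p :: nat
  assumes "prime p" "\<not> p dvd a"
  shows "(\<Prod>j=1..<p. a * j mod p) = (\<Prod>j=1..<p. j)"
proof -
  have cop: "coprime a p" using prime_imp_coprime[OF assms] by (simp add: coprime_commute)
  have inj: "inj_on (\<lambda>j. a * j mod p) {1..<p}"
  proof (rule inj_onI)
    fix i j assume ij: "i \<in> {1..<p}" "j \<in> {1..<p}" "a * i mod p = a * j mod p"
    then have "[i = j] (mod p)"
      using cong_mult_lcancel_nat[OF cop] by (simp add: cong_def)
    then show "i = j" using ij by (simp add: cong_def)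
  qed
  have sub: "(\<lambda>j. a * j mod p) ` {1..<p} \<subseteq> {1..<p}"
  proof
    fix y assume "y \<in> (\<lambda>j. a * j mod p) ` {1..<p}"
    then obtain j where j: "j \<in> {1..<p}" "y = a * j mod p" by auto
    have "\<not> p dvd a * j"
      using j assms by (auto simp: prime_dvd_mult_iff dest: dvd_imp_le)
    then show "y \<in> {1..<p}" using j assms by (auto simp: dvd_eq_mod_eq_0 prime_gt_0_nat)
  qed
  have "bij_betw (\<lambda>j. a * j mod p) {1..<p} {1..<p}"
    using inj sub endo_inj_surj[OF _ sub inj] by (auto simp: bij_betw_def)
  then show ?thesis by (rule prod.reindex_bij_betw)
qed

text \<open>The division takes place in the rationals, so \<open>power_eq_fermat_quotient\<close> is
  immediate; integrality is proved separately from Fermat's little theorem.\<close>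

definition fermat_quotient :: "nat \<Rightarrow> nat \<Rightarrow> rat" where
  "fermat_quotient p a = (of_nat a ^ (p - 1) - 1) / of_nat p"

context
  fixes p :: nat
  assumes p: "prime p" "p > 3"
begin

lemma coprime_small: "0 < k \<Longrightarrow> k < p \<Longrightarrow> coprime k p"
  using p by (metis coprime_commute nat_dvd_not_less prime_imp_coprime)

lemma p_integral_divide_small:
  "p_integral p x \<Longrightarrow> 0 < k \<Longrightarrow> k < p \<Longrightarrow> p_integral p (x / of_nat k)"
  by (intro p_integral_divide coprime_small)

lemma p_integral_harmonic: "m < p \<Longrightarrow> p_integral p (harmonic m)"
  unfolding harmonic_def by (auto intro!: p_integral_divide_small)

lemma rat_cong_inverse_diff:
  assumes "0 < k" "k < p"
  shows "rat_cong p 1 (1 / of_nat (p - k)) (- (1 / of_nat k))"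
proof (rule rat_congI)
  show "p_integral p (- (1 / of_nat k))" using assms by (auto intro!: p_integral_divide_small)
  show "p_integral p (1 / of_nat (p - k) / of_nat k)"
    using assms by (intro p_integral_divide_small) auto
  show "1 / of_nat (p - k) = (- (1 / of_nat k) + of_nat p ^ 1 * (1 / of_nat (p - k) / of_nat k) :: rat)"
    using assms by (simp add: of_nat_diff field_simps)
qed

text \<open>The substitution i \<mapsto> p - i negates the sum modulo p, so twice the sum vanishes,
  and 2 is a unit.\<close>

lemma harmonic_p_minus_1: "rat_cong p 1 (harmonic (p - 1)) 0"
proof -
  have "harmonic (p - 1) = (\<Sum>i=1..p-1. 1 / of_nat (p - i))"
    unfolding harmonic_def by (rule sum.reindex_bij_witness[of _ "\<lambda>i. p - i" "\<lambda>i. p - i"]) auto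
  also have "rat_cong p 1 \<dots> (\<Sum>i=1..p-1. - (1 / of_nat i))"
    using p by (intro rat_cong_sum rat_cong_inverse_diff) auto
  also have "\<dots> = - harmonic (p - 1)" by (simp add: harmonic_def sum_negf)
  finally have "rat_cong p 1 (harmonic (p - 1) + harmonic (p - 1)) (- harmonic (p - 1) + harmonic (p - 1))"
    using p by (intro rat_cong_add rat_cong_refl p_integral_harmonic) auto
  then have "rat_cong p 1 (1 / of_nat 2 * (harmonic (p - 1) + harmonic (p - 1))) (1 / of_nat 2 * (- harmonic (p - 1) + harmonic (p - 1)))"
    using p by (intro rat_cong_cmult p_integral_divide_small) auto
  then show ?thesis by simp
qed

text \<open>Going down from p - 1, the removed terms 1 / (p - i) are congruent to - 1 / i, so
  removing them builds up \<open>harmonic k\<close>.\<close>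

lemma harmonic_reflect: "k < p \<Longrightarrow> rat_cong p 1 (harmonic (p - 1 - k)) (harmonic k)"
proof (induction k)
  case 0
  show ?case using harmonic_p_minus_1 by simp
next
  case (Suc k)
  define q where "q = p - 1 - Suc k"
  have "p - 1 - k = Suc q" "p - Suc k = Suc q" using Suc by (auto simp: q_def)
  then have "harmonic q = harmonic (p - 1 - k) - 1 / of_nat (p - Suc k)"
    by (simp only: harmonic_Suc add_diff_cancel_right')
  also have "rat_cong p 1 \<dots> (harmonic k - (- (1 / of_nat (Suc k))))"
    using Suc by (intro rat_cong_diff rat_cong_inverse_diff Suc.IH) auto
  finally show ?case by (simp add: harmonic_Suc q_def)
qed

lemma p_integral_fermat_quotient:
  assumes "\<not> p dvd a"
  shows "p_integral p (fermat_quotient p a)"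
proof -
  have "[a ^ (p - 1) = 1] (mod p)" using fermat_theorem[OF p(1) assms] .
  then have "int p dvd int a ^ (p - 1) - 1"
    by (metis cong_iff_dvd_diff cong_int_iff of_nat_1 of_nat_power)
  then obtain c where "int a ^ (p - 1) - 1 = int p * c" by (elim dvdE)
  then have "(of_int (int a ^ (p - 1) - 1) :: rat) = of_int (int p * c)" by simp
  then have "fermat_quotient p a = of_int c"
    using p by (simp add: fermat_quotient_def)
  then show ?thesis by simp
qed

lemma power_eq_fermat_quotient:
  "of_nat a ^ (p - 1) = 1 + of_nat p * fermat_quotient p a"
  using p by (simp add: fermat_quotient_def)

text \<open>The logarithm rule: in (1 + p q_a)(1 + p q_b) the cross term is divisible by
  p^2.\<close>

lemma fermat_quotient_mult:
  assumes "\<not> p dvd a" "\<not> p dvd b"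
  shows "rat_cong p 1 (fermat_quotient p (a * b)) (fermat_quotient p a + fermat_quotient p b)"
proof (rule rat_congI)
  show "p_integral p (fermat_quotient p a + fermat_quotient p b)"
    "p_integral p (fermat_quotient p a * fermat_quotient p b)"
    using assms p_integral_fermat_quotient by auto
  have "1 + of_nat p * fermat_quotient p (a * b) =
      (1 + of_nat p * fermat_quotient p a) * (1 + of_nat p * fermat_quotient p b)"
    unfolding power_eq_fermat_quotient[symmetric] by (simp add: power_mult_distrib)
  then have "of_nat p * fermat_quotient p (a * b) = of_nat p *
      (fermat_quotient p a + fermat_quotient p b + of_nat p ^ 1 * (fermat_quotient p a * fermat_quotient p b))"
    by (simp add: algebra_simps)
  then show "fermat_quotient p (a * b) = fermat_quotient p a + fermat_quotient p b +
      of_nat p ^ 1 * (fermat_quotient p a * fermat_quotient p b)"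
    using p by simp
qed

text \<open>Write \<open>a j = p \<lfloor>a j / p\<rfloor> + r\<^sub>j\<close>. The residues \<open>r\<^sub>j\<close> permute \<open>1, \<dots>, p - 1\<close>, so \<open>a ^ (p - 1)\<close> is
  the product of the quotients \<open>a j / r\<^sub>j = 1 + p \<lfloor>a j / p\<rfloor> / r\<^sub>j\<close>.\<close>

lemma fermat_quotient_floor_sum:
  assumes "\<not> p dvd a"
  shows "rat_cong p 1 (of_nat a * fermat_quotient p a) (\<Sum>j=1..<p. of_nat (a * j div p) / of_nat j)"
proof -
  define r f where "r = (\<lambda>j. a * j mod p)" and "f = (\<lambda>j. a * j div p)"
  have r: "0 < r j" "r j < p" if "j \<in> {1..<p}" for j
  proof -
    have "\<not> p dvd a * j"
      using that assms p by (auto simp: prime_dvd_mult_iff dest: dvd_imp_le)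
    then show "0 < r j" "r j < p" using p by (simp_all add: r_def mod_greater_zero_iff_not_dvd)
  qed
  have rf: "(of_nat a * of_nat j :: rat) = of_nat p * of_nat (f j) + of_nat (r j)" for j
    unfolding r_def f_def by (simp flip: of_nat_add of_nat_mult)
  have P: "(\<Prod>j=1..<p. of_nat (r j) :: rat) = (\<Prod>j=1..<p. of_nat j)"
    using arg_cong[OF prod_mult_mod_prime[OF p(1) assms], of "of_nat :: nat \<Rightarrow> rat"]
    by (simp only: r_def of_nat_prod)
  have nz: "(\<Prod>j=1..<p. of_nat j :: rat) \<noteq> 0" by simp
  have "of_nat a ^ (p - 1) * (\<Prod>j=1..<p. of_nat j :: rat) = (\<Prod>j=1..<p. of_nat a * of_nat j)"
    by (simp add: prod.distrib)
  also have "\<dots> = (\<Prod>j=1..<p. (1 + of_nat p * (of_nat (f j) / of_nat (r j))) * of_nat (r j))"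
  proof (rule prod.cong[OF refl])
    fix j assume "j \<in> {1..<p}"
    then have "(of_nat (r j) :: rat) \<noteq> 0" using r by fastforce
    then show "of_nat a * of_nat j = (1 + of_nat p * (of_nat (f j) / of_nat (r j))) * (of_nat (r j) :: rat)"
      unfolding rf by (simp add: ring_distribs)
  qed
  also have "\<dots> = (\<Prod>j=1..<p. 1 + of_nat p * (of_nat (f j) / of_nat (r j))) * (\<Prod>j=1..<p. of_nat j)"
    unfolding prod.distrib P ..
  finally have "of_nat a ^ (p - 1) = (\<Prod>j=1..<p. 1 + of_nat p * (of_nat (f j) / of_nat (r j) :: rat))"
    using nz by simp
  moreover have "rat_cong p 2 (\<Prod>j=1..<p. 1 + of_nat p * (of_nat (f j) / of_nat (r j)))
      (1 + of_nat p * (\<Sum>j=1..<p. of_nat (f j) / of_nat (r j)))"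
    using r by (intro rat_cong_prod_1_plus p_integral_divide_small) auto
  ultimately have "rat_cong p 2 (1 + of_nat p * fermat_quotient p a)
      (1 + of_nat p * (\<Sum>j=1..<p. of_nat (f j) / of_nat (r j)))"
    unfolding power_eq_fermat_quotient by simp
  then obtain z where z: "p_integral p z" "1 + of_nat p * fermat_quotient p a =
       1 + of_nat p * (\<Sum>j=1..<p. of_nat (f j) / of_nat (r j)) + of_nat p ^ 2 * z"
    by (rule rat_congE)
  \<comment> \<open>Cancelling the common factor p turns the congruence modulo p^2 into one modulo
    p.\<close>
  have "of_nat p * fermat_quotient p a =
      of_nat p * ((\<Sum>j=1..<p. of_nat (f j) / of_nat (r j)) + of_nat p ^ 1 * z)"
    using z(2) by (simp add: algebra_simps power2_eq_square)
  then have "fermat_quotient p a = (\<Sum>j=1..<p. of_nat (f j) / of_nat (r j)) + of_nat p ^ 1 * z"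
    using p by simp
  then have "rat_cong p 1 (fermat_quotient p a) (\<Sum>j=1..<p. of_nat (f j) / of_nat (r j))"
    using z r by (intro rat_congI[of p _ z] p_integral_sum p_integral_divide_small) auto
  then have "rat_cong p 1 (of_nat a * fermat_quotient p a)
      (of_nat a * (\<Sum>j=1..<p. of_nat (f j) / of_nat (r j)))"
    by (rule rat_cong_cmult) simp
  also have "of_nat a * (\<Sum>j=1..<p. of_nat (f j) / of_nat (r j)) =
      (\<Sum>j=1..<p. of_nat a * (of_nat (f j) / of_nat (r j) :: rat))"
    by (rule sum_distrib_left)
  also have "rat_cong p 1 \<dots> (\<Sum>j=1..<p. of_nat (f j) / of_nat j)"
  proof (rule rat_cong_sum)
    fix j assume j: "j \<in> {1..<p}"
    \<comment> \<open>The residue \<open>r j\<close> is traded for j by means of a j \<equiv> r_j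
      modulo p; the exact difference of the two sides is p f_j^2 / (r_j j).\<close>
    show "rat_cong p 1 (of_nat a * (of_nat (f j) / of_nat (r j))) (of_nat (f j) / of_nat j)"
    proof (rule rat_congI)
      show "p_integral p (of_nat (f j) / of_nat j)"
        using j by (auto intro!: p_integral_divide_small)
      show "p_integral p (of_nat (f j) ^ 2 / of_nat (r j) / of_nat j)"
        using j r[OF j] by (intro p_integral_divide_small) auto
      have "of_nat (f j) * (of_nat a * of_nat j) = of_nat (f j) * (of_nat p * of_nat (f j) + of_nat (r j) :: rat)"
        by (simp only: rf)
      then show "of_nat a * (of_nat (f j) / of_nat (r j)) =
          of_nat (f j) / of_nat j + of_nat p ^ 1 * (of_nat (f j) ^ 2 / of_nat (r j) / of_nat j :: rat)"
        using j r[OF j] by (simp add: field_simps power2_eq_square)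
    qed
  qed
  finally show ?thesis unfolding f_def .
qed

text \<open>Double counting: \<lfloor>a j / p\<rfloor> is the number of i < a with \<lfloor>i p /
  a\<rfloor> < j. After exchanging the sums, the inner one is a tail of
  \<open>harmonic (p - 1)\<close>, which vanishes modulo p.\<close>

lemma lerch:
  assumes "\<not> p dvd a"
  shows "rat_cong p 1 (of_nat a * fermat_quotient p a) (- (\<Sum>i=1..<a. harmonic (i * p div a)))"
proof -
  have a: "a > 0" using assms by (auto intro!: Nat.gr0I)
  have count: "(of_nat (a * j div p) :: rat) = (\<Sum>i=1..<a. if i * p div a < j then 1 else 0)"
    if j: "j \<in> {1..<p}" for j
  proof -
    have "{i \<in> {1..<a}. i * p div a < j} = {1..a * j div p}"
    proof safe
      fix i assume i: "i \<in> {1..<a}" "i * p div a < j"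
      then have "i * p < a * j" using a by (simp add: div_less_iff_less_mult mult.commute)
      then show "i \<in> {1..a * j div p}" using i p
        by (auto simp: less_eq_div_iff_mult_less_eq prime_gt_0_nat)
    next
      fix i assume i: "i \<in> {1..a * j div p}"
      then have le: "i * p \<le> a * j" using p
        by (auto simp: less_eq_div_iff_mult_less_eq prime_gt_0_nat)
      \<comment> \<open>Equality would make p divide a or j; excluding it makes the bound strict, as
        the count requires.\<close>
      have "i * p \<noteq> a * j"
      proof
        assume "i * p = a * j"
        then have "p dvd a * j" by (metis dvd_triv_right)
        then show False using assms j p by (auto simp: prime_dvd_mult_iff dest: dvd_imp_le)
      qed
      with le show "i * p div a < j" using a by (simp add: div_less_iff_less_mult mult.commute)
      have "i * p < a * p" using le \<open>i * p \<noteq> a * j\<close> j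
        by (metis atLeastLessThan_iff le_neq_implies_less less_le_trans mult_le_mono2 nat_less_le)
      then show "i \<in> {1..<a}" using i by simp
    qed
    then show ?thesis by (simp flip: sum.inter_filter)
  qed
  have inner: "(\<Sum>j=1..<p. (if i * p div a < j then 1 else 0) / of_nat j) =
      harmonic (p - 1) - harmonic (i * p div a)" if i: "i \<in> {1..<a}" for i
  proof -
    have lt: "i * p div a < p" using i p a by (simp add: div_less_iff_less_mult prime_gt_0_nat)
    have "(\<Sum>j=1..<p. (if i * p div a < j then 1 else 0) / of_nat j) =
       (\<Sum>j\<in>{1..<p}. if i * p div a < j then 1 / of_nat j else 0 :: rat)"
      by (rule sum.cong) auto
    also have "\<dots> = (\<Sum>j\<in>{1..p - 1} - {1..i * p div a}. 1 / of_nat j)"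
      by (subst sum.inter_filter[symmetric]) (auto intro!: sum.cong)
    also have "\<dots> = harmonic (p - 1) - harmonic (i * p div a)"
      unfolding harmonic_def using lt by (subst sum_diff) auto
    finally show ?thesis .
  qed
  have "(\<Sum>j=1..<p. of_nat (a * j div p) / of_nat j :: rat) =
     (\<Sum>j=1..<p. \<Sum>i=1..<a. (if i * p div a < j then 1 else 0) / of_nat j)"
    by (rule sum.cong) (simp_all only: count sum_divide_distrib)
  also have "\<dots> = (\<Sum>i=1..<a. \<Sum>j=1..<p. (if i * p div a < j then 1 else 0) / of_nat j)"
    by (rule sum.swap)
  also have "\<dots> = (\<Sum>i=1..<a. harmonic (p - 1) - harmonic (i * p div a))"
    by (rule sum.cong) (simp_all only: inner)
  finally have eq: "(\<Sum>j=1..<p. of_nat (a * j div p) / of_nat j :: rat) = \<dots>" .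
  have lt: "i * p div a < p" if "i \<in> {1..<a}" for i
    using that p a by (simp add: div_less_iff_less_mult prime_gt_0_nat)
  have "rat_cong p 1 (\<Sum>i=1..<a. harmonic (p - 1) - harmonic (i * p div a))
      (\<Sum>i=1..<a. 0 - harmonic (i * p div a))"
    by (intro rat_cong_sum rat_cong_diff harmonic_p_minus_1 rat_cong_refl p_integral_harmonic lt)
  then show ?thesis
    using rat_cong_trans[OF fermat_quotient_floor_sum[OF assms]] unfolding eq by (simp add: sum_negf)
qed

section \<open>Harmonic numbers at the floors of p/2, p/3, p/4 and p/6\<close>

lemma rat_cong_half:
  assumes "rat_cong p m (2 * x) y" shows "rat_cong p m x (y / 2)"
proof -
  have "p_integral p (1 / of_nat 2)" using p by (intro p_integral_divide_small) auto
  from rat_cong_cmult[OF assms this] show ?thesis by simp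
qed

lemma not_dvd_small: "0 < a \<Longrightarrow> a < p \<Longrightarrow> \<not> p dvd a"
  by (auto dest: dvd_imp_le)

lemma mod_6_cases:
  obtains k where "p = 6 * k + 1" | k where "p = 6 * k + 5"
proof -
  have "\<not> 2 dvd p" "\<not> 3 dvd p"
    using p primes_dvd_imp_eq[of 2 p] primes_dvd_imp_eq[of 3 p] by auto
  then have "p mod 6 = 1 \<or> p mod 6 = 5" by presburger
  then show ?thesis using that by (metis mult_div_mod_eq)
qed

lemma mod_4_cases:
  obtains k where "p = 4 * k + 1" | k where "p = 4 * k + 3"
proof -
  have "\<not> 2 dvd p" using p primes_dvd_imp_eq[of 2 p] by auto
  then have "p mod 4 = 1 \<or> p mod 4 = 3" by presburger
  then show ?thesis using that by (metis mult_div_mod_eq)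
qed

text \<open>Since i p / d is not an integer here, the floors of i p / d and (d - i) p / d add up to
  p - 1. This is the shape that \<open>harmonic_reflect\<close> needs.\<close>

lemma reflected_quotients:
  "2 * p div 3 = p - 1 - p div 3" "3 * p div 4 = p - 1 - p div 4"
  "4 * p div 6 = p - 1 - p div 3" "5 * p div 6 = p - 1 - p div 6"
proof -
  show "3 * p div 4 = p - 1 - p div 4"
  proof (rule mod_4_cases)
    fix k assume k: "p = 4 * k + 1"
    have "p div 4 = k" "3 * p div 4 = 3 * k" by (rule div_nat_eqI; use k in simp)+
    then show ?thesis using k by simp
  next
    fix k assume k: "p = 4 * k + 3"
    have "p div 4 = k" "3 * p div 4 = 3 * k + 2" by (rule div_nat_eqI; use k in simp)+
    then show ?thesis using k by simp
  qed
  have "2 * p div 3 = p - 1 - p div 3 \<and> 4 * p div 6 = p - 1 - p div 3 \<and> 5 * p div 6 = p - 1 - p div 6"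
  proof (rule mod_6_cases)
    fix k assume k: "p = 6 * k + 1"
    have "p div 3 = 2 * k" "2 * p div 3 = 4 * k" "p div 6 = k" "4 * p div 6 = 4 * k" "5 * p div 6 = 5 * k"
      by (rule div_nat_eqI; use k in simp)+
    then show ?thesis using k by simp
  next
    fix k assume k: "p = 6 * k + 5"
    have "p div 3 = 2 * k + 1" "2 * p div 3 = 4 * k + 3" "p div 6 = k"
      "4 * p div 6 = 4 * k + 3" "5 * p div 6 = 5 * k + 4"
      by (rule div_nat_eqI; use k in simp)+
    then show ?thesis using k by simp
  qed
  then show "2 * p div 3 = p - 1 - p div 3" "4 * p div 6 = p - 1 - p div 3" "5 * p div 6 = p - 1 - p div 6"
    by simp_all
qed

lemma harmonic_half: "rat_cong p 1 (harmonic (p div 2)) (- 2 * fermat_quotient p 2)"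
proof -
  have nd: "\<not> p dvd 2" using p by (intro not_dvd_small) auto
  have "rat_cong p 1 (- harmonic (p div 2)) (2 * fermat_quotient p 2)"
    using rat_cong_sym[OF lerch[OF nd]] by (simp add: numeral_2_eq_2)
  from rat_cong_minus[OF this] show ?thesis by simp
qed

text \<open>In Lerch's formula for 3 the two harmonic numbers agree modulo p by reflection.\<close>

lemma harmonic_third: "rat_cong p 1 (harmonic (p div 3)) (- 3 * fermat_quotient p 3 / 2)"
proof -
  have nd: "\<not> p dvd 3" using p by (intro not_dvd_small) auto
  have "{1..<3::nat} = {1, 2}" by auto
  then have "rat_cong p 1 (3 * fermat_quotient p 3) (- (harmonic (p div 3) + harmonic (2 * p div 3)))"
    using lerch[OF nd] by simp
  then obtain z where z: "p_integral p z"
    "3 * fermat_quotient p 3 = - (harmonic (p div 3) + harmonic (2 * p div 3)) + of_nat p ^ 1 * z"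
    by (rule rat_congE)
  have "rat_cong p 1 (harmonic (2 * p div 3)) (harmonic (p div 3))"
    using harmonic_reflect[of "p div 3"] p by (simp add: reflected_quotients)
  then obtain w where w: "p_integral p w" "harmonic (2 * p div 3) = harmonic (p div 3) + of_nat p ^ 1 * w"
    by (rule rat_congE)
  have "rat_cong p 1 (2 * harmonic (p div 3)) (- 3 * fermat_quotient p 3)"
    by (rule rat_congI[where z = "z - w"])
      (use z w p_integral_fermat_quotient[OF nd] in \<open>auto simp: algebra_simps\<close>)
  from rat_cong_half[OF this] show ?thesis by simp
qed

text \<open>Lerch's formula for 4, with the outer terms equal by reflection, the middle one known
  from \<open>harmonic_half\<close>, and the quotient of 4 equal to twice that of 2.\<close>

lemma harmonic_fourth: "rat_cong p 1 (harmonic (p div 4)) (- 3 * fermat_quotient p 2)"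
proof -
  have nd: "\<not> p dvd 2" using p by (intro not_dvd_small) auto
  then have nd4: "\<not> p dvd 4" using prime_dvd_multD[OF p(1), of 2 2] by auto
  have "{1..<4::nat} = {1, 2, 3}" by auto
  moreover have "2 * p div 4 = p div 2" by presburger
  ultimately have "rat_cong p 1 (4 * fermat_quotient p 4)
      (- (harmonic (p div 4) + harmonic (p div 2) + harmonic (3 * p div 4)))"
    using lerch[OF nd4] by (simp add: add.assoc)
  then obtain z where z: "p_integral p z" "4 * fermat_quotient p 4 =
      - (harmonic (p div 4) + harmonic (p div 2) + harmonic (3 * p div 4)) + of_nat p ^ 1 * z"
    by (rule rat_congE)
  have "rat_cong p 1 (harmonic (3 * p div 4)) (harmonic (p div 4))"
    using harmonic_reflect[of "p div 4"] p by (simp add: reflected_quotients)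
  then obtain w where w: "p_integral p w" "harmonic (3 * p div 4) = harmonic (p div 4) + of_nat p ^ 1 * w"
    by (rule rat_congE)
  have "rat_cong p 1 (fermat_quotient p 4) (fermat_quotient p 2 + fermat_quotient p 2)"
    using fermat_quotient_mult[OF nd nd] by simp
  then obtain v where v: "p_integral p v"
    "fermat_quotient p 4 = fermat_quotient p 2 + fermat_quotient p 2 + of_nat p ^ 1 * v"
    by (rule rat_congE)
  obtain u where u: "p_integral p u" "harmonic (p div 2) = - 2 * fermat_quotient p 2 + of_nat p ^ 1 * u"
    using harmonic_half by (rule rat_congE)
  have "rat_cong p 1 (2 * harmonic (p div 4)) (- 6 * fermat_quotient p 2)"
    by (rule rat_congI[where z = "z - w - u - 4 * v"])
      (use z w v u p_integral_fermat_quotient[OF nd] in \<open>auto simp: algebra_simps\<close>)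
  from rat_cong_half[OF this] show ?thesis by simp
qed

text \<open>Reflection reduces the five terms of Lerch's formula for 6 to the floors of p/6, p/3 and
  p/2, of which the last two are already known.\<close>

lemma harmonic_sixth:
  "rat_cong p 1 (harmonic (p div 6)) (- 2 * fermat_quotient p 2 - 3 * fermat_quotient p 3 / 2)"
proof -
  have nd: "\<not> p dvd 2" "\<not> p dvd 3" using p not_dvd_small by auto
  \<comment> \<open>For p = 5 the size argument \<open>not_dvd_small\<close> fails, so 6 is
    factored.\<close>
  have nd6: "\<not> p dvd 6" using prime_dvd_multD[OF p(1), of 2 3] nd by auto
  have "{1..<6::nat} = {1, 2, 3, 4, 5}" by auto
  moreover have "2 * p div 6 = p div 3" "3 * p div 6 = p div 2" by presburger+
  ultimately have "rat_cong p 1 (6 * fermat_quotient p 6)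
      (- (harmonic (p div 6) + harmonic (p div 3) + harmonic (p div 2) +
        harmonic (4 * p div 6) + harmonic (5 * p div 6)))"
    using lerch[OF nd6] by (simp add: add.assoc)
  then obtain z where z: "p_integral p z" "6 * fermat_quotient p 6 =
      - (harmonic (p div 6) + harmonic (p div 3) + harmonic (p div 2) +
        harmonic (4 * p div 6) + harmonic (5 * p div 6)) + of_nat p ^ 1 * z"
    by (rule rat_congE)
  have r: "rat_cong p 1 (harmonic (5 * p div 6)) (harmonic (p div 6))"
     "rat_cong p 1 (harmonic (4 * p div 6)) (harmonic (p div 3))"
    using harmonic_reflect[of "p div 6"] harmonic_reflect[of "p div 3"] p
    by (simp_all add: reflected_quotients)
  obtain w where w: "p_integral p w" "harmonic (5 * p div 6) = harmonic (p div 6) + of_nat p ^ 1 * w"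
    using r(1) by (rule rat_congE)
  obtain w' where w': "p_integral p w'" "harmonic (4 * p div 6) = harmonic (p div 3) + of_nat p ^ 1 * w'"
    using r(2) by (rule rat_congE)
  have "rat_cong p 1 (fermat_quotient p 6) (fermat_quotient p 2 + fermat_quotient p 3)"
    using fermat_quotient_mult[OF nd] by simp
  then obtain v where v: "p_integral p v"
    "fermat_quotient p 6 = fermat_quotient p 2 + fermat_quotient p 3 + of_nat p ^ 1 * v"
    by (rule rat_congE)
  obtain u where u: "p_integral p u" "harmonic (p div 2) = - 2 * fermat_quotient p 2 + of_nat p ^ 1 * u"
    using harmonic_half by (rule rat_congE)
  obtain t where t: "p_integral p t" "harmonic (p div 3) = - 3 * fermat_quotient p 3 / 2 + of_nat p ^ 1 * t"
    using harmonic_third by (rule rat_congE)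
  have "rat_cong p 1 (2 * harmonic (p div 6)) (- 4 * fermat_quotient p 2 - 3 * fermat_quotient p 3)"
    by (rule rat_congI[where z = "z - w - w' - u - 2 * t - 6 * v"])
      (use z w w' v u t p_integral_fermat_quotient[OF nd(1)] p_integral_fermat_quotient[OF nd(2)]
        in \<open>auto simp: algebra_simps\<close>)
  from rat_cong_half[OF this] show ?thesis by (simp add: diff_divide_distrib)
qed

end

section \<open>The recurrences\<close>

text \<open>\<open>bin_term k x\<close> is the product of the generalised binomial coefficients of
  \<open>x\<close> and \<open>- 1 - x\<close> over \<open>k\<close>.\<close>

definition bin_term :: "nat \<Rightarrow> rat \<Rightarrow> rat" where
  "bin_term k x = (\<Prod>i<k. (x - of_nat i) * (- 1 - x - of_nat i) / of_nat (Suc i) ^ 2)"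

text \<open>A partial product of Euler's product for \<open>sin (\<pi> x) / (\<pi> x)\<close>.\<close>

definition sine_prod :: "nat \<Rightarrow> rat \<Rightarrow> rat" where
  "sine_prod n x = (\<Prod>i<n. 1 - x\<^sup>2 / of_nat (Suc i) ^ 2)"

lemma bin_term_0 [simp]: "bin_term 0 x = 1"
  by (simp add: bin_term_def)

lemma bin_term_Suc:
  "bin_term (Suc k) x = bin_term k x * ((x - of_nat k) * (- 1 - x - of_nat k) / of_nat (Suc k) ^ 2)"
  by (simp add: bin_term_def)

lemma sine_prod_0 [simp]: "sine_prod 0 x = 1"
  by (simp add: sine_prod_def)

lemma sine_prod_Suc:
  "sine_prod (Suc n) x = sine_prod n x * (1 - x\<^sup>2 / of_nat (Suc n) ^ 2)"
  by (simp add: sine_prod_def)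

lemma sine_prod_Suc_factored:
  "sine_prod (Suc n) x =
    sine_prod n x * ((of_nat (Suc n) - x) * (of_nat (Suc n) + x) / of_nat (Suc n) ^ 2)"
proof -
  have "(1 :: rat) = of_nat (Suc n) ^ 2 / of_nat (Suc n) ^ 2" by simp
  then have "1 - x\<^sup>2 / of_nat (Suc n) ^ 2 = (of_nat (Suc n) ^ 2 - x\<^sup>2) / of_nat (Suc n) ^ 2"
    by (simp only: diff_divide_distrib)
  also have "of_nat (Suc n) ^ 2 - x\<^sup>2 = (of_nat (Suc n) - x) * (of_nat (Suc n) + x)"
    by (simp only: power2_eq_square) (simp only: algebra_simps)
  finally show ?thesis unfolding sine_prod_Suc by simp
qed

lemma bin_term_reflect: "bin_term k (- 1 - x) = bin_term k x"
  unfolding bin_term_def by (rule prod.cong) (auto simp: algebra_simps)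

text \<open>Pair x - i with x + i for 1 \<le> i \<le> k; the factors x and x + k + 1 remain. The
  explicit factor x is what makes the terms small at multiples of p.\<close>

lemma bin_term_eq_sine_prod:
  "bin_term (Suc k) x = - x * (x + of_nat (Suc k)) / of_nat (Suc k) ^ 2 * sine_prod k x"
proof (induction k)
  case 0
  show ?case by (simp add: bin_term_Suc algebra_simps)
next
  case (Suc k)
  \<comment> \<open>The inverse squares are kept as indeterminates c and d, which leaves a
    polynomial identity free of side conditions.\<close>
  have ring: "- x * (x + N) * c * g * ((x - N) * (- 1 - x - N) * d) =
    - x * (x + (N + 1)) * d * (g * ((N - x) * (N + x) * c))" for N c d g :: rat
    by (simp add: algebra_simps)
  have "(of_nat (Suc (Suc k)) :: rat) = of_nat (Suc k) + 1" by simp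
  with ring[of "of_nat (Suc k)" "inverse (of_nat (Suc k) ^ 2)" "sine_prod k x" "inverse (of_nat (Suc (Suc k)) ^ 2)"]
  show ?case unfolding bin_term_Suc[of "Suc k"] Suc.IH sine_prod_Suc_factored
    by (simp only: divide_inverse mult.assoc)
qed

lemma bin_term_pred_eq_sine_prod:
  "bin_term (Suc k) (x - 1) = x * (of_nat (Suc k) - x) / of_nat (Suc k) ^ 2 * sine_prod k x"
proof -
  have "bin_term (Suc k) (x - 1) = bin_term (Suc k) (- x)"
    using bin_term_reflect[of "Suc k" "- x"] by simp
  also have "sine_prod k (- x) = sine_prod k x" by (simp add: sine_prod_def)
  then have "bin_term (Suc k) (- x) = x * (of_nat (Suc k) - x) / of_nat (Suc k) ^ 2 * sine_prod k x"
    by (simp add: bin_term_eq_sine_prod)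
  finally show ?thesis .
qed

text \<open>Shifting x by 1 shifts each of the products of i - x and of i + x by one index, so all
  but their end factors cancel. Denominators are cleared so that poles cause no exception.\<close>

lemma sine_prod_shift:
  "sine_prod n (x + 1) * ((of_nat n - x) * (1 + x)) = - (x * (of_nat n + 1 + x)) * sine_prod n x"
proof (induction n)
  case 0
  show ?case by (simp add: algebra_simps)
next
  case (Suc n)
  define N :: rat where "N = of_nat (Suc n)"
  define c where "c = inverse (N ^ 2)"
  have n: "of_nat n = N - 1" by (simp add: N_def)
  have ring: "g * ((N - (x + 1)) * (N + (x + 1)) * c) * ((N - x) * (1 + x)) =
     g * ((N - 1 - x) * (1 + x)) * ((N + 1 + x) * (N - x) * c)" for g
    by (simp add: algebra_simps)
  have "sine_prod (Suc n) (x + 1) * ((N - x) * (1 + x)) =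
     (sine_prod n (x + 1) * ((N - 1 - x) * (1 + x))) * ((N + 1 + x) * (N - x) * c)"
    unfolding sine_prod_Suc_factored N_def[symmetric] divide_inverse c_def[symmetric] by (rule ring)
  also have "\<dots> = - (x * (N + 1 + x)) * sine_prod (Suc n) x"
    unfolding Suc.IH[unfolded n] sine_prod_Suc_factored N_def[symmetric] divide_inverse c_def[symmetric]
    by simp
  finally show ?case unfolding N_def .
qed

section \<open>Shift relations for the two sums\<close>

definition bin_sum :: "nat \<Rightarrow> rat \<Rightarrow> rat" where
  "bin_sum n x = (\<Sum>k\<le>n. bin_term k x)"

definition odd_bin_sum :: "nat \<Rightarrow> rat \<Rightarrow> rat" where
  "odd_bin_sum n x = (\<Sum>k\<le>n. bin_term k x / of_nat (2 * k + 1))"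

text \<open>The k-th terms at x and x - 1 add up to twice the increment of \<open>sine_prod\<close>,
  so the sum telescopes.\<close>

lemma bin_sum_shift: "bin_sum n x + bin_sum n (x - 1) = 2 * sine_prod n x"
proof (induction n)
  case (Suc n)
  have ring: "- x * (x + N) * c * g + x * (N - x) * c * g = 2 * (g * (1 - x * x * c) - g)"
    for N c g :: rat by (simp add: algebra_simps)
  have "bin_term (Suc n) x + bin_term (Suc n) (x - 1) = 2 * (sine_prod (Suc n) x - sine_prod n x)"
    unfolding bin_term_eq_sine_prod[of n x] bin_term_pred_eq_sine_prod sine_prod_Suc divide_inverse
      power2_eq_square[of x] by (rule ring)
  with Suc show ?case by (simp add: bin_sum_def)
qed (simp add: bin_sum_def)

text \<open>The weights 2 x + 1 and 2 x - 1 make the combined terms of index N acquire the factor 2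
  N + 1, which cancels the denominator; what is left telescopes as before.\<close>

lemma odd_bin_sum_shift:
  "(2 * x + 1) * odd_bin_sum n x - (2 * x - 1) * odd_bin_sum n (x - 1) = 2 * sine_prod n x"
proof (induction n)
  case (Suc n)
  define N :: rat where "N = of_nat (Suc n)"
  define e :: rat where "e = inverse (of_nat (2 * Suc n + 1))"
  have N: "2 * N + 1 = of_nat (2 * Suc n + 1)" by (simp add: N_def)
  have nz: "(of_nat (2 * Suc n + 1) :: rat) \<noteq> 0" by (subst of_nat_eq_0_iff) simp
  have e: "(2 * N + 1) * e = 1" unfolding e_def N by (rule right_inverse[OF nz])
  have ring: "(2 * x + 1) * (- x * (x + N) * c * g * e) - (2 * x - 1) * (x * (N - x) * c * g * e) =
     2 * (g * (1 - x * x * c) - g)" for c g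
  proof -
    have "(2 * x + 1) * (- x * (x + N) * c * g * e) - (2 * x - 1) * (x * (N - x) * c * g * e) =
       - 2 * x * x * c * g * ((2 * N + 1) * e)"
      by (simp add: algebra_simps)
    also have "\<dots> = 2 * (g * (1 - x * x * c) - g)"
      unfolding e by (simp add: algebra_simps)
    finally show ?thesis .
  qed
  have "(2 * x + 1) * (bin_term (Suc n) x * e) - (2 * x - 1) * (bin_term (Suc n) (x - 1) * e) =
      2 * (sine_prod (Suc n) x - sine_prod n x)"
    unfolding bin_term_eq_sine_prod[of n x] bin_term_pred_eq_sine_prod sine_prod_Suc N_def[symmetric]
      divide_inverse power2_eq_square[of x] by (rule ring)
  moreover have "odd_bin_sum (Suc n) y = odd_bin_sum n y + bin_term (Suc n) y * e" for y
    unfolding odd_bin_sum_def sum.atMost_Suc e_def divide_inverse ..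
  ultimately show ?case using Suc by (simp add: ring_distribs)
qed (simp add: odd_bin_sum_def)

lemma bin_sum_add_nat:
  "bin_sum n (y + of_nat m) =
    (- 1) ^ m * (bin_sum n y + 2 * (\<Sum>j=1..m. (- 1) ^ j * sine_prod n (y + of_nat j)))"
proof (induction m)
  case (Suc m)
  define s where "s = (\<Sum>j=1..m. (- 1) ^ j * sine_prod n (y + of_nat j))"
  have "bin_sum n (y + of_nat (Suc m)) = 2 * sine_prod n (y + of_nat (Suc m)) - bin_sum n (y + of_nat m)"
    using bin_sum_shift[of n "y + of_nat (Suc m)"] by (simp add: algebra_simps)
  moreover have "(- 1) ^ m * (- 1) ^ m = (1 :: rat)" by (simp flip: power_add)
  moreover have "2 * g - w * (b + 2 * s) = (- w) * (b + 2 * (s + (- w) * g))" if "w * w = 1" for g w b :: rat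
  proof -
    have "(- w) * (b + 2 * (s + (- w) * g)) = 2 * (w * w) * g - w * (b + 2 * s)"
      by (simp add: algebra_simps)
    then show ?thesis using that by simp
  qed
  moreover have "(\<Sum>j=1..Suc m. (- 1) ^ j * sine_prod n (y + of_nat j)) =
      s + (- ((- 1) ^ m)) * sine_prod n (y + of_nat (Suc m))"
    by (simp add: s_def)
  moreover have "(- 1) ^ Suc m = (- ((- 1) ^ m) :: rat)" by simp
  ultimately show ?case unfolding Suc.IH s_def[symmetric] by metis
qed simp

text \<open>The weight 2 x - 1 is 2 (x - 1) + 1, so the weighted sum itself grows by 2
  \<open>sine_prod n x\<close> at each unit step.\<close>

lemma odd_bin_sum_add_nat:
  "(2 * (y + of_nat m) + 1) * odd_bin_sum n (y + of_nat m) =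
    (2 * y + 1) * odd_bin_sum n y + 2 * (\<Sum>j=1..m. sine_prod n (y + of_nat j))"
proof (induction m)
  case (Suc m)
  have e: "2 * (y + of_nat (Suc m)) - 1 = 2 * (y + of_nat m) + 1" "y + of_nat (Suc m) - 1 = y + of_nat m"
    by simp_all
  have "(2 * (y + of_nat (Suc m)) + 1) * odd_bin_sum n (y + of_nat (Suc m)) =
      2 * sine_prod n (y + of_nat (Suc m)) + (2 * (y + of_nat m) + 1) * odd_bin_sum n (y + of_nat m)"
    using odd_bin_sum_shift[of "y + of_nat (Suc m)" n] unfolding e by linarith
  then show ?case unfolding Suc.IH by simp
qed simp

section \<open>The binomial summands as values of \<open>bin_term\<close>\<close>

lemma binomial_eq_fact_quotient:
  "(of_nat (a + b choose a) :: rat) = fact (a + b) / (fact a * fact b)"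
  by (simp add: binomial_fact)

text \<open>The left-hand side is (3k)! / (k!^3 27^k), whose consecutive ratio is (k + 1/3)(k + 2/3)
  / (k + 1)^2.\<close>

lemma bin_term_third:
  "of_nat ((2 * k choose k) * (3 * k choose k)) / 27 ^ k = bin_term k (- 1 / 3)"
proof (induction k)
  case (Suc k)
  have f: "of_nat ((2 * k choose k) * (3 * k choose k)) = (fact (3 * k) / fact k ^ 3 :: rat)" for k
    using binomial_eq_fact_quotient[of k k] binomial_eq_fact_quotient[of k "2 * k"]
    by (simp add: power3_eq_cube mult_2[of k, symmetric])
  have e: "3 * Suc k = Suc (Suc (Suc (3 * k)))" by simp
  have cancel: "c * F / (d * f) ^ 3 / (27 * w) = F / f ^ 3 / w * (c / (27 * d ^ 3))" for c d f w F :: rat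
    by (simp add: power_mult_distrib mult_ac)
  define K :: rat where "K = of_nat k"
  have "K \<ge> 0" by (simp add: K_def)
  then have nz: "K + 1 \<noteq> 0" by linarith
  have "fact (3 * Suc k) = (3 * K + 3) * (3 * K + 2) * (3 * K + 1) * fact (3 * k)"
    unfolding e fact_Suc by (simp add: K_def algebra_simps)
  moreover have "fact (Suc k) = (K + 1) * fact k" by (simp add: K_def algebra_simps)
  ultimately have "fact (3 * Suc k) / fact (Suc k) ^ 3 / 27 ^ Suc k =
      fact (3 * k) / fact k ^ 3 / 27 ^ k * ((3 * K + 3) * (3 * K + 2) * (3 * K + 1) / (27 * (K + 1) ^ 3))"
    using cancel by (simp only: power_Suc[of 27])
  also have "(3 * K + 3) * (3 * K + 2) * (3 * K + 1) / (27 * (K + 1) ^ 3) =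
      (- 1 / 3 - K) * (- 1 - (- 1 / 3) - K) / (K + 1) ^ 2"
    using nz by (simp add: frac_eq_eq) (simp add: power2_eq_square power3_eq_cube algebra_simps)
  also have "K + 1 = of_nat (Suc k)" by (simp add: K_def)
  finally show ?case unfolding bin_term_Suc Suc.IH[symmetric] f K_def .
qed simp

text \<open>Here the consecutive ratio is (k + 1/6)(k + 5/6) / (k + 1)^2.\<close>

lemma bin_term_sixth:
  "of_nat ((6 * k choose (3 * k)) * (3 * k choose k)) / 432 ^ k = bin_term k (- 1 / 6)"
proof (induction k)
  case (Suc k)
  have f: "of_nat ((6 * k choose (3 * k)) * (3 * k choose k)) =
      (fact (6 * k) / (fact (3 * k) * fact (2 * k) * fact k) :: rat)" for k
    using binomial_eq_fact_quotient[of "3 * k" "3 * k"] binomial_eq_fact_quotient[of k "2 * k"]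
    by simp
  have e: "3 * Suc k = Suc (Suc (Suc (3 * k)))" "2 * Suc k = Suc (Suc (2 * k))"
    "6 * Suc k = Suc (Suc (Suc (Suc (Suc (Suc (6 * k))))))" by simp_all
  have cancel: "c * F / (d * f * (d' * f') * (d'' * f'')) / (432 * w) =
    F / (f * f' * f'') / w * (c / (432 * (d * d' * d'')))" for c d d' d'' f f' f'' w F :: rat
    by (simp add: mult_ac)
  define K :: rat where "K = of_nat k"
  have "K \<ge> 0" by (simp add: K_def)
  then have nz: "K + 1 \<noteq> 0" "2 * K + 1 \<noteq> 0" "3 * K + 1 \<noteq> 0" "3 * K + 2 \<noteq> 0" by linarith+
  have "fact (6 * Suc k) = (6 * K + 6) * (6 * K + 5) * (6 * K + 4) * (6 * K + 3) * (6 * K + 2) * (6 * K + 1) * fact (6 * k)"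
    unfolding e fact_Suc by (simp add: K_def algebra_simps)
  moreover have "fact (3 * Suc k) = (3 * (K + 1)) * (3 * K + 2) * (3 * K + 1) * fact (3 * k)"
    unfolding e fact_Suc by (simp add: K_def algebra_simps)
  moreover have "fact (2 * Suc k) = (2 * (K + 1)) * (2 * K + 1) * fact (2 * k)"
    unfolding e fact_Suc by (simp add: K_def algebra_simps)
  moreover have "fact (Suc k) = (K + 1) * fact k" by (simp add: K_def algebra_simps)
  ultimately have "fact (6 * Suc k) / (fact (3 * Suc k) * fact (2 * Suc k) * fact (Suc k)) / 432 ^ Suc k =
      fact (6 * k) / (fact (3 * k) * fact (2 * k) * fact k) / 432 ^ k *
      ((6 * K + 6) * (6 * K + 5) * (6 * K + 4) * (6 * K + 3) * (6 * K + 2) * (6 * K + 1) /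
       (432 * ((3 * (K + 1)) * (3 * K + 2) * (3 * K + 1) * ((2 * (K + 1)) * (2 * K + 1)) * (K + 1))))"
    using cancel by (simp only: power_Suc[of 432])
  \<comment> \<open>The constants 6, 2, 3, 2 pulled out of four factors give 72; the division by 3
    compensates for keeping 3 (K + 1) intact, as it occurs in the denominator.\<close>
  also have "(6 * K + 6) * (6 * K + 5) * (6 * K + 4) * (6 * K + 3) * (6 * K + 2) * (6 * K + 1) =
     72 * ((3 * (K + 1)) * (3 * K + 2) * (3 * K + 1) * (2 * K + 1)) * ((6 * K + 5) * (6 * K + 1)) / 3"
    by (simp add: algebra_simps)
  also have "72 * ((3 * (K + 1)) * (3 * K + 2) * (3 * K + 1) * (2 * K + 1)) * ((6 * K + 5) * (6 * K + 1)) / 3 /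
       (432 * ((3 * (K + 1)) * (3 * K + 2) * (3 * K + 1) * ((2 * (K + 1)) * (2 * K + 1)) * (K + 1))) =
      (6 * K + 5) * (6 * K + 1) / 36 / (K + 1) ^ 2"
    using nz by (simp add: frac_eq_eq power2_eq_square)
  also have "(6 * K + 5) * (6 * K + 1) / 36 = (- 1 / 6 - K) * (- 1 - (- 1 / 6) - K)"
    by (simp add: field_simps)
  also have "K + 1 = of_nat (Suc k)" by (simp add: K_def)
  finally show ?case unfolding bin_term_Suc Suc.IH[symmetric] f K_def .
qed simp

text \<open>Here the consecutive ratio is (k + 1/4)(k + 3/4) / (k + 1)^2.\<close>

lemma bin_term_fourth:
  "of_nat ((4 * k choose (2 * k)) * (2 * k choose k)) / 64 ^ k = bin_term k (- 1 / 4)"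
proof (induction k)
  case (Suc k)
  have f: "of_nat ((4 * k choose (2 * k)) * (2 * k choose k)) =
      (fact (4 * k) / (fact (2 * k) * fact k ^ 2) :: rat)" for k
    using binomial_eq_fact_quotient[of "2 * k" "2 * k"] binomial_eq_fact_quotient[of k k]
    by (simp add: mult_2[of k, symmetric] power2_eq_square)
  have e: "2 * Suc k = Suc (Suc (2 * k))" "4 * Suc k = Suc (Suc (Suc (Suc (4 * k))))" by simp_all
  have cancel: "c * F / (d * f * (d' * f') ^ 2) / (64 * w) =
    F / (f * f' ^ 2) / w * (c / (64 * (d * d' ^ 2)))" for c d d' f f' w F :: rat
    by (simp add: power_mult_distrib mult_ac)
  define K :: rat where "K = of_nat k"
  have "K \<ge> 0" by (simp add: K_def)
  then have nz: "K + 1 \<noteq> 0" "2 * K + 1 \<noteq> 0" by linarith+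
  have "fact (4 * Suc k) = (4 * K + 4) * (4 * K + 3) * (4 * K + 2) * (4 * K + 1) * fact (4 * k)"
    unfolding e fact_Suc by (simp add: K_def algebra_simps)
  moreover have "fact (2 * Suc k) = (2 * (K + 1)) * (2 * K + 1) * fact (2 * k)"
    unfolding e fact_Suc by (simp add: K_def algebra_simps)
  moreover have "fact (Suc k) = (K + 1) * fact k" by (simp add: K_def algebra_simps)
  ultimately have "fact (4 * Suc k) / (fact (2 * Suc k) * fact (Suc k) ^ 2) / 64 ^ Suc k =
      fact (4 * k) / (fact (2 * k) * fact k ^ 2) / 64 ^ k *
      ((4 * K + 4) * (4 * K + 3) * (4 * K + 2) * (4 * K + 1) /
       (64 * ((2 * (K + 1)) * (2 * K + 1) * (K + 1) ^ 2)))"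
    using cancel by (simp only: power_Suc[of 64])
  also have "(4 * K + 4) * (4 * K + 3) * (4 * K + 2) * (4 * K + 1) =
     4 * ((2 * (K + 1)) * (2 * K + 1)) * ((4 * K + 3) * (4 * K + 1))"
    by (simp add: algebra_simps)
  also have "4 * ((2 * (K + 1)) * (2 * K + 1)) * ((4 * K + 3) * (4 * K + 1)) /
       (64 * ((2 * (K + 1)) * (2 * K + 1) * (K + 1) ^ 2)) =
      (4 * K + 3) * (4 * K + 1) / 16 / (K + 1) ^ 2"
    using nz by simp
  also have "(4 * K + 3) * (4 * K + 1) / 16 = (- 1 / 4 - K) * (- 1 - (- 1 / 4) - K)"
    by (simp add: field_simps)
  also have "K + 1 = of_nat (Suc k)" by (simp add: K_def)
  finally show ?case unfolding bin_term_Suc Suc.IH[symmetric] f K_def .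
qed simp

section \<open>The sums near multiples of \<open>p\<close>\<close>

context
  fixes p :: nat
  assumes p: "prime p" "p > 3"
begin

lemma p_integral_sine_prod: "n < p \<Longrightarrow> p_integral p x \<Longrightarrow> p_integral p (sine_prod n x)"
  unfolding sine_prod_def power_divide[symmetric]
  by (intro p_integral_prod p_integral_diff p_integral_power p_integral_divide_small[OF p]) auto

text \<open>The argument enters only through its square, which is divisible by p^2.\<close>

lemma sine_prod_at_p_multiple:
  "n < p \<Longrightarrow> p_integral p t \<Longrightarrow> rat_cong p 2 (sine_prod n (of_nat p * t)) 1"
proof (induction n)
  case (Suc n)
  have t: "p_integral p (t / of_nat (Suc n))" using Suc by (intro p_integral_divide_small[OF p]) auto
  have "rat_cong p 2 (1 - (of_nat p * t)\<^sup>2 / of_nat (Suc n) ^ 2) 1"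
  proof (rule rat_congI)
    show "p_integral p (- ((t / of_nat (Suc n)) ^ 2))" using t by blast
  qed (simp_all add: power_divide power_mult_distrib)
  from rat_cong_mult[OF Suc.IH this] show ?case using Suc by (simp add: sine_prod_Suc)
qed auto

text \<open>The closed form starts with the factor - p t, so its other factors matter only modulo
  p.\<close>

lemma bin_term_at_p_multiple:
  assumes "0 < k" "k < p" "p_integral p t"
  shows "rat_cong p 2 (bin_term k (of_nat p * t)) (- (of_nat p * (t / of_nat k)))"
proof -
  obtain m where m: "k = Suc m" using assms by (cases k) auto
  have t: "p_integral p (t / of_nat k)" using assms by (intro p_integral_divide_small[OF p]) auto
  have k: "(of_nat k :: rat) \<noteq> 0" using assms by simp
  have "rat_cong p 2 (- (of_nat p * t) * (of_nat p * t + of_nat k) / of_nat k ^ 2) (- (of_nat p * (t / of_nat k)))"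
  proof (rule rat_congI)
    show "p_integral p (- (of_nat p * (t / of_nat k)))" "p_integral p (- ((t / of_nat k) ^ 2))"
      using t by blast+
  qed (use k in \<open>simp add: field_simps power2_eq_square\<close>)
  from rat_cong_mult[OF this sine_prod_at_p_multiple[of m t]] show ?thesis
    using assms unfolding m bin_term_eq_sine_prod by simp
qed

lemma bin_sum_at_p_multiple:
  assumes "n < p" "p_integral p t"
  shows "rat_cong p 2 (bin_sum n (of_nat p * t)) (1 - of_nat p * t * harmonic n)"
  using assms(1)
proof (induction n)
  case (Suc n)
  have "rat_cong p 2 (bin_sum n (of_nat p * t) + bin_term (Suc n) (of_nat p * t))
     (1 - of_nat p * t * harmonic n + - (of_nat p * (t / of_nat (Suc n))))"
    using Suc assms by (intro rat_cong_add bin_term_at_p_multiple Suc.IH) auto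
  then show ?case by (simp add: bin_sum_def harmonic_Suc algebra_simps del: of_nat_Suc)
qed (auto simp: bin_sum_def)

end

section \<open>Arguments j + p t with 0 \<le> j \<le> (p - 1) / 2\<close>

context
  fixes p n :: nat
  assumes p: "prime p" "p > 3" and n: "p = 2 * n + 1"
begin

lemma n_less_p: "n < p" "j \<le> n \<Longrightarrow> j < p"
  using n by auto

text \<open>Because \<open>n + 1 + x = p - (n - x)\<close>, the shift relation of \<open>sine_prod\<close> makes \<open>x * sine_prod n x\<close>
  invariant modulo \<open>p\<^sup>2\<close> under \<open>x \<mapsto> x + 1\<close>.\<close>

lemma arg_mult_sine_prod:
  assumes t: "p_integral p t"
  shows "j \<le> n \<Longrightarrow> rat_cong p 2 ((of_nat p * t + of_nat j) * sine_prod n (of_nat p * t + of_nat j)) (of_nat p * t)"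
proof (induction j)
  case 0
  have "rat_cong p 2 (of_nat p * t * sine_prod n (of_nat p * t)) (of_nat p * t * 1)"
    using t n by (intro rat_cong_cmult sine_prod_at_p_multiple[OF p]) auto
  then show ?case by simp
next
  case (Suc j)
  define x where "x = of_nat p * t + of_nat j"
  have x: "p_integral p x" "p_integral p (x + 1)" using t by (auto simp: x_def)
  have G: "p_integral p (sine_prod n x)" "p_integral p (sine_prod n (x + 1))"
    using x n_less_p by (auto intro!: p_integral_sine_prod[OF p])
  \<comment> \<open>The aim is y \<equiv> 0. Multiplied by n - x, which is the unit n - j up to a
    multiple of p, y becomes - p x G(x), and x G(x) is divisible by p by the induction
    hypothesis.\<close>
  define y where "y = (x + 1) * sine_prod n (x + 1) - x * sine_prod n x"
  have IH: "rat_cong p 2 (x * sine_prod n x) (of_nat p * t)" using Suc by (simp add: x_def)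
  then obtain z where z: "p_integral p z" "x * sine_prod n x = of_nat p * t + of_nat p ^ 2 * z"
    by (rule rat_congE)
  have np: "of_nat n + 1 + x = of_nat p - (of_nat n - x)" using n by simp
  have c: "of_nat (n - j) + of_nat p * (- t) = of_nat n - x" using Suc by (simp add: x_def of_nat_diff)
  have "(of_nat n - x) * y =
      sine_prod n (x + 1) * ((of_nat n - x) * (1 + x)) - (of_nat n - x) * (x * sine_prod n x)"
    by (simp add: y_def algebra_simps)
  also have "\<dots> = - (of_nat p * (x * sine_prod n x))"
    unfolding sine_prod_shift np by (simp add: algebra_simps)
  also have "\<dots> = of_nat p * 0 + of_nat p ^ 2 * (- (t + of_nat p * z))"
    unfolding z(2) by (simp add: algebra_simps power2_eq_square)
  finally have "rat_cong p 2 ((of_nat (n - j) + of_nat p * (- t)) * y) (of_nat p * 0)"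
    unfolding c using t z by (intro rat_congI[where z = "- (t + of_nat p * z)"]) auto
  then have "rat_cong p 2 y (of_nat p * 0 / of_nat (n - j))"
    by (rule rat_cong_unit_cancel) (use Suc n_less_p t G x in \<open>auto simp: y_def intro!: coprime_small[OF p]\<close>)
  from rat_cong_add[OF this IH] show ?case by (simp add: y_def x_def algebra_simps)
qed

lemma sine_prod_cong:
  assumes "p_integral p t" "0 < j" "j \<le> n"
  shows "rat_cong p 2 (sine_prod n (of_nat p * t + of_nat j)) (of_nat p * t / of_nat j)"
proof (rule rat_cong_unit_cancel)
  show "rat_cong p 2 ((of_nat j + of_nat p * t) * sine_prod n (of_nat p * t + of_nat j)) (of_nat p * t)"
    using arg_mult_sine_prod[OF assms(1,3)] by (simp add: add.commute)
qed (use assms n_less_p in \<open>auto intro!: p_integral_sine_prod[OF p] coprime_small[OF p]\<close>)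

text \<open>In the unrolled recurrence each \<open>sine_prod\<close> value becomes p t / j, so an
  alternating harmonic sum appears.\<close>

lemma bin_sum_cong:
  assumes t: "p_integral p t" and "m \<le> n"
  shows "rat_cong p 2 (bin_sum n (of_nat p * t + of_nat m))
    ((- 1) ^ m * (1 - of_nat p * t * harmonic n + 2 * (of_nat p * t * (harmonic (m div 2) - harmonic m))))"
proof -
  have "rat_cong p 2 (\<Sum>j=1..m. (- 1) ^ j * sine_prod n (of_nat p * t + of_nat j))
      (\<Sum>j=1..m. (- 1) ^ j * (of_nat p * t / of_nat j))"
    using assms by (intro rat_cong_sum rat_cong_cmult sine_prod_cong) auto
  also have "(\<Sum>j=1..m. (- 1) ^ j * (of_nat p * t / of_nat j)) =
      of_nat p * t * (\<Sum>j=1..m. (- 1) ^ j / of_nat j)"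
    by (simp add: sum_distrib_left mult_ac)
  finally show ?thesis
    unfolding alternating_harmonic_sum bin_sum_add_nat using t n
    by (intro rat_cong_cmult rat_cong_add bin_sum_at_p_multiple[OF p]) auto
qed

text \<open>The starting value for unrolling the second recurrence. All terms with k < n have
  denominators prime to p, and the last one is treated separately.\<close>

lemma odd_bin_sum_at_p_multiple:
  assumes t: "p_integral p t"
  shows "rat_cong p 2 ((2 * (of_nat p * t) + 1) * odd_bin_sum n (of_nat p * t))
    (1 + 2 * t - 2 * (of_nat p * t * harmonic n))"
proof -
  let ?P = "of_nat p :: rat" and ?x = "of_nat p * t"
  define N :: rat where "N = 1 / of_nat n"
  have n0: "n > 1" using p n by simp
  then have N: "p_integral p N" unfolding N_def using n by (intro p_integral_divide_small[OF p]) auto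
  have nN: "of_nat n * N = 1" using n0 by (simp add: N_def)
  have "?P = 2 * of_nat n + 1" using n by simp
  then have "?P * N = 2 * (of_nat n * N) + N" by (simp add: algebra_simps)
  \<comment> \<open>From p = 2 n + 1, the inverse of n is - 2 modulo p; inserting the equation into
    itself gives - 2 - 2 p modulo p^2.\<close>
  then have N1: "N = - 2 + ?P * N" using nN by simp
  then have N2: "N = - 2 + ?P * (- 2 + ?P * N)" by simp
  have H: "p_integral p (harmonic n)" using n by (intro p_integral_harmonic[OF p]) simp

  \<comment> \<open>The term \<open>k = n\<close> carries the denominator \<open>2 n + 1 = p\<close>.\<close>
  obtain m where m: "n = Suc m" using n0 by (cases n) auto
  have low: "rat_cong p 2 (odd_bin_sum m ?x) (1 - ?P * (t * (2 * harmonic n + 4)))"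
  proof -
    have "{..m} = insert 0 {1..<n}" using m by auto
    then have "odd_bin_sum m ?x = 1 + (\<Sum>k=1..<n. bin_term k ?x / of_nat (2 * k + 1))"
      by (simp add: odd_bin_sum_def)
    moreover have c: "rat_cong p 2 (\<Sum>k=1..<n. bin_term k ?x / of_nat (2 * k + 1))
        (\<Sum>k=1..<n. - (?P * (t / of_nat k)) / of_nat (2 * k + 1))"
    proof (rule rat_cong_sum)
      fix k assume k: "k \<in> {1..<n}"
      have "rat_cong p 2 (1 / of_nat (2 * k + 1) * bin_term k ?x)
         (1 / of_nat (2 * k + 1) * - (?P * (t / of_nat k)))"
        using k n t by (intro rat_cong_cmult bin_term_at_p_multiple[OF p] p_integral_divide_small[OF p]) auto
      then show "rat_cong p 2 (bin_term k ?x / of_nat (2 * k + 1)) (- (?P * (t / of_nat k)) / of_nat (2 * k + 1))"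
        by (simp add: mult.commute)
    qed
    moreover have "(\<Sum>k=1..<n. - (?P * (t / of_nat k)) / of_nat (2 * k + 1)) =
        - (?P * (t * (\<Sum>k=1..<n. 1 / (of_nat k * of_nat (2 * k + 1)))))"
      by (simp add: sum_distrib_left sum_negf)
    ultimately have *: "rat_cong p 2 (odd_bin_sum m ?x)
        (1 + - (?P * (t * (2 * harmonic n - 2 * harmonic (2 * n) + 2 - N))))"
      using sum_inverse_mult_odd[of n] n0 rat_cong_add[OF rat_cong_refl[OF p_integral_1] c]
      by (simp only: N_def)
    have "2 * n = p - 1" using n by simp
    then obtain z where z: "p_integral p z" "harmonic (2 * n) = 0 + ?P ^ 1 * z"
      using harmonic_p_minus_1[OF p] by (auto elim: rat_congE)
    have "t * (2 * harmonic n - 2 * harmonic (2 * n) + 2 - N) =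
        t * (2 * harmonic n + 4) + ?P ^ 1 * (t * (- 2 * z - N))"
      unfolding z(2) by (subst N1) (simp add: algebra_simps)
    then have "rat_cong p 1 (t * (2 * harmonic n - 2 * harmonic (2 * n) + 2 - N)) (t * (2 * harmonic n + 4))"
      using t H z N by (intro rat_congI[where z = "t * (- 2 * z - N)"]) auto
    from rat_cong_minus[OF rat_cong_lift[OF this]]
    have "rat_cong p 2 (1 + - (?P * (t * (2 * harmonic n - 2 * harmonic (2 * n) + 2 - N))))
       (1 + - (?P * (t * (2 * harmonic n + 4))))"
      by (intro rat_cong_add) auto
    from rat_cong_trans[OF * this] show ?thesis by simp
  qed

  \<comment> \<open>The denominator p cancels exactly against the factor p t of the closed form, so
    the remaining factors are needed only modulo p^2.\<close>
  have top: "rat_cong p 2 (bin_term n ?x / ?P) (2 * t + ?P * (2 * t - 4 * t * t))"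
  proof -
    have "bin_term n ?x = - ?x * (?x + of_nat n) / of_nat n ^ 2 * sine_prod m ?x"
      unfolding m by (rule bin_term_eq_sine_prod)
    also have "\<dots> / ?P = - t * (?P * t * N * N + of_nat n * N * N) * sine_prod m ?x"
      using p n0 by (simp add: N_def power2_eq_square field_simps)
    also have "\<dots> = - t * (?P * t * N * N + N) * sine_prod m ?x" using nN by simp
    finally have e: "bin_term n ?x / ?P = \<dots>" .
    have "(- 2 + ?P * N) * (- 2 + ?P * N) = 4 + ?P * (- 4 * N + ?P * (N * N))"
      by (simp add: algebra_simps)
    then have N3: "N * N = 4 + ?P * (- 4 * N + ?P * (N * N))" unfolding N1[symmetric] .
    have "- t * (?P * t * N * N + N) = - t * (?P * t * (N * N)) - t * N" by (simp add: algebra_simps)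
    also have "\<dots> = - t * (?P * t * (4 + ?P * (- 4 * N + ?P * (N * N)))) - t * (- 2 + ?P * (- 2 + ?P * N))"
      using N2 N3 by (intro arg_cong2[of _ _ _ _ "(-)"] arg_cong2[of _ _ _ _ "(*)"] refl)
    also have "\<dots> = 2 * t + ?P * (2 * t - 4 * t * t) + ?P ^ 2 * (t * t * (4 * N - ?P * (N * N)) - t * N)"
      by (simp add: algebra_simps power2_eq_square)
    finally have "rat_cong p 2 (- t * (?P * t * N * N + N)) (2 * t + ?P * (2 * t - 4 * t * t))"
      using t N by (intro rat_congI[where z = "t * t * (4 * N - ?P * (N * N)) - t * N"]) auto
    from rat_cong_mult[OF this sine_prod_at_p_multiple[OF p, of m t]] show ?thesis
      unfolding e using t n m by simp
  qed

  have "odd_bin_sum n ?x = odd_bin_sum m ?x + bin_term n ?x / ?P"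
    using n by (simp add: odd_bin_sum_def m)
  then have "rat_cong p 2 ((2 * ?x + 1) * odd_bin_sum n ?x)
     ((2 * ?x + 1) * (1 - ?P * (t * (2 * harmonic n + 4)) + (2 * t + ?P * (2 * t - 4 * t * t))))"
    using rat_cong_add[OF low top] t by (intro rat_cong_cmult) auto
  \<comment> \<open>The factor 2 p t + 1 contributes 2 p t (1 + 2 t), cancelling every term of order
    p except the harmonic one; the witness collects the terms of order p^2.\<close>
  also have "rat_cong p 2 \<dots> (1 + 2 * t - 2 * (?x * harmonic n))"
    by (rule rat_congI[where z = "2 * t * (- (t * (2 * harmonic n + 4)) + (2 * t - 4 * t * t))"])
      (use t H in \<open>auto simp: algebra_simps power2_eq_square\<close>)
  finally show ?thesis .
qed

lemma odd_bin_sum_cong: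
  assumes t: "p_integral p t" and "m \<le> n"
  shows "rat_cong p 2 ((2 * (of_nat p * t + of_nat m) + 1) * odd_bin_sum n (of_nat p * t + of_nat m))
    (1 + 2 * t - 2 * (of_nat p * t * harmonic n) + 2 * (of_nat p * t * harmonic m))"
proof -
  have "rat_cong p 2 (\<Sum>j=1..m. sine_prod n (of_nat p * t + of_nat j)) (\<Sum>j=1..m. of_nat p * t / of_nat j)"
    using assms by (intro rat_cong_sum sine_prod_cong) auto
  also have "(\<Sum>j=1..m. of_nat p * t / of_nat j) = of_nat p * t * harmonic m"
    by (simp add: sum_distrib_left harmonic_def)
  finally show ?thesis
    unfolding odd_bin_sum_add_nat using t by (intro rat_cong_add odd_bin_sum_at_p_multiple rat_cong_cmult) auto
qed

end

section \<open>The three supercongruences\<close>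

text \<open>As p is odd, p div 3 is even exactly when p \<equiv> 1 modulo 3. This is the sign that
  \<open>bin_sum_cong\<close> produces for m = p div 3.\<close>

lemma Legendre_3:
  assumes "p = 6 * k + 1 \<or> p = 6 * k + 5"
  shows "Legendre (int p) 3 = (- 1) ^ (p div 3)"
  using assms
proof
  assume k: "p = 6 * k + 1"
  have "p div 3 = 2 * k" by (rule div_nat_eqI; use k in simp)
  moreover have "int p mod 3 = 1" using k by presburger
  moreover have "QuadRes 3 (int p)"
    unfolding QuadRes_def by (rule exI[of _ 1]) (use \<open>int p mod 3 = 1\<close> in \<open>simp add: cong_def\<close>)
  ultimately show ?thesis by (simp add: Legendre_def cong_def)
next
  assume k: "p = 6 * k + 5"
  have "p div 3 = 2 * k + 1" by (rule div_nat_eqI; use k in simp)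
  moreover have p3: "int p mod 3 = 2" using k by presburger
  moreover have "\<not> QuadRes 3 (int p)"
  proof
    assume "QuadRes 3 (int p)"
    then obtain y where "y\<^sup>2 mod 3 = (2 :: int)" unfolding QuadRes_def cong_def p3 by auto
    moreover have "y\<^sup>2 mod 3 = (y mod 3)\<^sup>2 mod 3" by (simp add: power_mod)
    moreover have "y mod 3 = 0 \<or> y mod 3 = 1 \<or> y mod 3 = 2" by presburger
    ultimately show False by auto
  qed
  ultimately show ?thesis by (simp add: Legendre_def cong_def)
qed

text \<open>Euler's criterion gives the congruence modulo p; both sides are 1 or - 1, and p > 2 does
  not divide their possible nonzero differences.\<close>

lemma Legendre_minus_1:
  assumes "prime p" "p > 2"
  shows "Legendre (- 1) (int p) = (- 1) ^ ((p - 1) div 2)"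
proof -
  have c: "int p dvd Legendre (- 1) (int p) - (- 1) ^ ((p - 1) div 2)"
    using euler_criterion[OF assms, of "- 1"] by (simp add: cong_iff_dvd_diff)
  have "\<not> [- 1 = 0] (mod int p)" using assms by (auto simp: cong_iff_dvd_diff)
  then have "Legendre (- 1) (int p) \<in> {1, - 1}" by (auto simp: Legendre_def)
  moreover have "(- 1) ^ ((p - 1) div 2) \<in> {1, - 1 :: int}" using neg_one_even_power neg_one_odd_power by blast
  moreover have "\<not> int p dvd 2" "\<not> int p dvd - 2" using assms by (auto dest: zdvd_imp_le)
  ultimately show ?thesis using c by auto
qed

lemma bin_sum_reflect: "bin_sum n (- 1 - x) = bin_sum n x"
  by (simp add: bin_sum_def bin_term_reflect)

lemma odd_bin_sum_reflect: "odd_bin_sum n (- 1 - x) = odd_bin_sum n x"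
  by (simp add: odd_bin_sum_def bin_term_reflect)

context
  fixes p n :: nat
  assumes p: "prime p" "p > 3" and n: "p = 2 * n + 1"
begin

lemma harmonic_n: "rat_cong p 1 (harmonic n) (- 2 * fermat_quotient p 2)"
  using harmonic_half[OF p] n by simp

lemma bin_sum_third:
  "rat_cong p 2 (bin_sum n (- 1 / 3)) (of_int (Legendre (int p) 3) * ((2 ^ p + 1) / 3))"
proof -
  define m where "m = p div 3"
  define t :: rat where "t = - 1 / 3"
  have "p_integral p (- 1 / of_nat 3)" using p by (intro p_integral_divide_small[OF p]) auto
  then have t: "p_integral p t" by (simp add: t_def)
  obtain k where k: "p = 6 * k + 1 \<or> p = 6 * k + 5" using mod_6_cases[OF p] by metis
  \<comment> \<open>With m = \<lfloor>p / 3\<rfloor>, m - p / 3 is - 1/3 or - 2/3, and reflection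
    exchanges these two arguments.\<close>
  have arg: "bin_sum n (of_nat p * t + of_nat m) = bin_sum n (- 1 / 3)"
    using k
  proof
    assume k: "p = 6 * k + 1"
    have "m = 2 * k" unfolding m_def by (rule div_nat_eqI; use k in simp)
    then have "of_nat p * t + of_nat m = - 1 / 3" using k by (simp add: t_def field_simps)
    then show ?thesis by simp
  next
    assume k: "p = 6 * k + 5"
    have "m = 2 * k + 1" unfolding m_def by (rule div_nat_eqI; use k in simp)
    then have "of_nat p * t + of_nat m = - 1 - (- 1 / 3)" using k by (simp add: t_def field_simps)
    then show ?thesis by (simp only: bin_sum_reflect)
  qed
  have m2: "m div 2 = p div 6" by (simp add: m_def div_mult2_eq[of p 3 2, symmetric])
  have "m \<le> n" using n by (simp add: m_def)
  note main = bin_sum_cong[OF p n t this, unfolded arg m2, unfolded m_def]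
  obtain u where u: "p_integral p u" "harmonic n = - 2 * fermat_quotient p 2 + of_nat p ^ 1 * u"
    using harmonic_n by (rule rat_congE)
  obtain v where v: "p_integral p v" "harmonic (p div 3) = - 3 * fermat_quotient p 3 / 2 + of_nat p ^ 1 * v"
    using harmonic_third[OF p] by (rule rat_congE)
  obtain w where w: "p_integral p w" "harmonic (p div 6) =
      - 2 * fermat_quotient p 2 - 3 * fermat_quotient p 3 / 2 + of_nat p ^ 1 * w"
    using harmonic_sixth[OF p] by (rule rat_congE)
  have q: "p_integral p (fermat_quotient p 2)"
    using p not_dvd_small[OF p, of 2] by (intro p_integral_fermat_quotient[OF p]) auto
  note main
  \<comment> \<open>The quotients of 3 cancel in the difference of the two harmonic numbers, so only
    the quotient of 2 survives.\<close>
  also have "rat_cong p 2 ((- 1) ^ (p div 3) * (1 - of_nat p * t * harmonic n +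
      2 * (of_nat p * t * (harmonic (p div 6) - harmonic (p div 3)))))
      ((- 1) ^ (p div 3) * (1 - 2 * (of_nat p * t * fermat_quotient p 2)))"
    unfolding u(2) v(2) w(2) by (intro rat_cong_cmult rat_congI[where z = "t * (2 * (w - v) - u)"])
      (use u(1) v(1) w(1) t q in \<open>auto simp: algebra_simps power2_eq_square\<close>)
  also have "1 - 2 * (of_nat p * t * fermat_quotient p 2) = (2 ^ p + 1) / 3"
  proof -
    have "(2 :: rat) ^ p = 2 * 2 ^ (p - 1)" using p by (simp flip: power_Suc)
    also have "\<dots> = 2 * (1 + of_nat p * fermat_quotient p 2)"
      using power_eq_fermat_quotient[OF p, of 2] by simp
    finally show ?thesis by (simp add: t_def)
  qed
  also have "(- 1) ^ (p div 3) = (of_int (Legendre (int p) 3) :: rat)"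
    using Legendre_3[OF k] by simp
  finally show ?thesis .
qed

lemma odd_bin_sum_sixth:
  "rat_cong p 2 (odd_bin_sum n (- 1 / 6)) (of_int (Legendre (int p) 3) * ((3 ^ p + 1) / 4))"
proof -
  define m where "m = p div 6"
  define t :: rat where "t = - 1 / 6"
  define s :: rat where "s = of_int (Legendre (int p) 3)"
  \<comment> \<open>The case p = 5 < 6 forces the detour through the factors 2 and 3.\<close>
  have cop: "coprime 6 p"
    using coprime_small[OF p, of 2] coprime_small[OF p, of 3] p coprime_mult_left_iff[of 2 3 p] by simp
  have "p_integral p (- 1 / of_nat 6)" using cop by (intro p_integral_divide) auto
  then have t: "p_integral p t" by (simp add: t_def)
  obtain k where k: "p = 6 * k + 1 \<or> p = 6 * k + 5" using mod_6_cases[OF p] by metis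
  have arg: "odd_bin_sum n (of_nat p * t + of_nat m) = odd_bin_sum n (- 1 / 6) \<and>
      2 * (of_nat p * t + of_nat m) + 1 = s * 2 / 3 \<and> s * s = 1"
    using k
  proof
    assume k: "p = 6 * k + 1"
    have m: "m = k" unfolding m_def by (rule div_nat_eqI; use k in simp)
    have "p div 3 = 2 * k" by (rule div_nat_eqI; use k in simp)
    then have s: "s = 1" using Legendre_3[of p k] k by (simp add: s_def)
    have "of_nat p * t + of_nat m = - 1 / 6" using k m by (simp add: t_def field_simps)
    then show ?thesis using s by simp
  next
    assume k: "p = 6 * k + 5"
    have m: "m = k" unfolding m_def by (rule div_nat_eqI; use k in simp)
    have "p div 3 = 2 * k + 1" by (rule div_nat_eqI; use k in simp)
    then have s: "s = - 1" using Legendre_3[of p k] k by (simp add: s_def)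
    have e: "of_nat p * t + of_nat m = - 1 - (- 1 / 6)" using k m by (simp add: t_def field_simps)
    show ?thesis unfolding e odd_bin_sum_reflect using s by simp
  qed
  have "m \<le> n" using n by (simp add: m_def)
  note main = odd_bin_sum_cong[OF p n t this]
  obtain u where u: "p_integral p u" "harmonic n = - 2 * fermat_quotient p 2 + of_nat p ^ 1 * u"
    using harmonic_n by (rule rat_congE)
  obtain w where w: "p_integral p w" "harmonic m =
      - 2 * fermat_quotient p 2 - 3 * fermat_quotient p 3 / 2 + of_nat p ^ 1 * w"
    using harmonic_sixth[OF p] unfolding m_def by (rule rat_congE)
  have q: "p_integral p (fermat_quotient p 3)"
    using p not_dvd_small[OF p, of 3] by (intro p_integral_fermat_quotient[OF p]) auto
  have "rat_cong p 2 (s * 2 / 3 * odd_bin_sum n (- 1 / 6))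
     (1 + 2 * t - 2 * (of_nat p * t * harmonic n) + 2 * (of_nat p * t * harmonic m))"
    using main by (simp only: arg)
  \<comment> \<open>The quotients of 2 in \<open>harmonic m\<close> and \<open>harmonic n\<close>
    cancel, leaving that of 3.\<close>
  also have "rat_cong p 2 \<dots> (1 + 2 * t - 3 * (of_nat p * t * fermat_quotient p 3))"
    unfolding u(2) w(2) by (rule rat_congI[where z = "2 * t * (w - u)"])
      (use u(1) w(1) t q in \<open>auto simp: algebra_simps power2_eq_square\<close>)
  finally have c: "rat_cong p 2 (s * 2 / 3 * odd_bin_sum n (- 1 / 6))
      (1 + 2 * t - 3 * (of_nat p * t * fermat_quotient p 3))" .
  \<comment> \<open>The inverse of the weight 2 s / 3 is 3 s / 2, because s * s = 1.\<close>
  have "p_integral p (3 * s / of_nat 2)" using p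
    by (intro p_integral_divide_small[OF p]) (auto simp: s_def)
  from rat_cong_cmult[OF c this]
  have "rat_cong p 2 (s * s * odd_bin_sum n (- 1 / 6))
     (s * (3 / 2 * (1 + 2 * t - 3 * (of_nat p * t * fermat_quotient p 3))))"
    by (simp add: mult_ac)
  also have "3 / 2 * (1 + 2 * t - 3 * (of_nat p * t * fermat_quotient p 3)) = (3 ^ p + 1) / 4"
  proof -
    have "(3 :: rat) ^ p = 3 * 3 ^ (p - 1)" using p by (simp flip: power_Suc)
    also have "\<dots> = 3 * (1 + of_nat p * fermat_quotient p 3)"
      using power_eq_fermat_quotient[OF p, of 3] by simp
    finally show ?thesis by (simp add: t_def field_simps)
  qed
  finally show ?thesis using arg by (simp add: s_def)
qed

lemma odd_bin_sum_fourth: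
  "rat_cong p 2 (odd_bin_sum n (- 1 / 4)) (of_int (Legendre (- 1) (int p)) * 2 ^ (p - 1))"
proof -
  define m where "m = p div 4"
  define t :: rat where "t = - 1 / 4"
  define s :: rat where "s = of_int (Legendre (- 1) (int p))"
  have "p_integral p (- 1 / of_nat 2 / of_nat 2)" using p by (intro p_integral_divide_small[OF p]) auto
  then have t: "p_integral p t" by (simp add: t_def)
  have leg: "s = (- 1) ^ n" using Legendre_minus_1[of p] p n by (simp add: s_def)
  have arg: "odd_bin_sum n (of_nat p * t + of_nat m) = odd_bin_sum n (- 1 / 4) \<and>
      2 * (of_nat p * t + of_nat m) + 1 = s / 2 \<and> s * s = 1"
  proof (rule mod_4_cases[OF p])
    fix k assume k: "p = 4 * k + 1"
    have m: "m = k" unfolding m_def by (rule div_nat_eqI; use k in simp)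
    have "n = 2 * k" using k n by simp
    then have s: "s = 1" using leg by simp
    have "of_nat p * t + of_nat m = - 1 / 4" using k m by (simp add: t_def field_simps)
    then show ?thesis using s by simp
  next
    fix k assume k: "p = 4 * k + 3"
    have m: "m = k" unfolding m_def by (rule div_nat_eqI; use k in simp)
    have "n = 2 * k + 1" using k n by simp
    then have s: "s = - 1" using leg by simp
    have e: "of_nat p * t + of_nat m = - 1 - (- 1 / 4)" using k m by (simp add: t_def field_simps)
    show ?thesis unfolding e odd_bin_sum_reflect using s by simp
  qed
  have "m \<le> n" using n by (simp add: m_def)
  note main = odd_bin_sum_cong[OF p n t this]
  obtain u where u: "p_integral p u" "harmonic n = - 2 * fermat_quotient p 2 + of_nat p ^ 1 * u"
    using harmonic_n by (rule rat_congE)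
  obtain w where w: "p_integral p w" "harmonic m = - 3 * fermat_quotient p 2 + of_nat p ^ 1 * w"
    using harmonic_fourth[OF p] unfolding m_def by (rule rat_congE)
  have q: "p_integral p (fermat_quotient p 2)"
    using p not_dvd_small[OF p, of 2] by (intro p_integral_fermat_quotient[OF p]) auto
  have "rat_cong p 2 (s / 2 * odd_bin_sum n (- 1 / 4))
     (1 + 2 * t - 2 * (of_nat p * t * harmonic n) + 2 * (of_nat p * t * harmonic m))"
    using main by (simp only: arg)
  \<comment> \<open>Here \<open>harmonic m\<close> - \<open>harmonic n\<close> is minus the quotient
    of 2, modulo p.\<close>
  also have "rat_cong p 2 \<dots> (1 + 2 * t - 2 * (of_nat p * t * fermat_quotient p 2))"
    unfolding u(2) w(2) by (rule rat_congI[where z = "2 * t * (w - u)"])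
      (use u(1) w(1) t q in \<open>auto simp: algebra_simps power2_eq_square\<close>)
  finally have c: "rat_cong p 2 (s / 2 * odd_bin_sum n (- 1 / 4))
      (1 + 2 * t - 2 * (of_nat p * t * fermat_quotient p 2))" .
  have "p_integral p (2 * s)" by (auto simp: s_def)
  from rat_cong_cmult[OF c this]
  have "rat_cong p 2 (s * s * odd_bin_sum n (- 1 / 4))
     (s * (2 * (1 + 2 * t - 2 * (of_nat p * t * fermat_quotient p 2))))"
    by (simp add: mult_ac)
  also have "2 * (1 + 2 * t - 2 * (of_nat p * t * fermat_quotient p 2)) = 2 ^ (p - 1)"
    using power_eq_fermat_quotient[OF p, of 2] by (simp add: t_def)
  finally show ?thesis using arg by (simp add: s_def)
qed

end

theorem theorem1p2:
  fixes p :: nat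
  assumes "prime p" and "p > 3"
  shows "rat_cong p 2
           (\<Sum>k=0..(p - 1) div 2.
              of_nat ((2 * k choose k) * (3 * k choose k)) / 27 ^ k)
           (of_int (Legendre (int p) 3) * ((2 ^ p + 1) / 3)) \<and>
         rat_cong p 2
           (\<Sum>k=0..(p - 1) div 2.
              of_nat ((6 * k choose (3 * k)) * (3 * k choose k)) / (of_nat (2 * k + 1) * 432 ^ k))
           (of_int (Legendre (int p) 3) * ((3 ^ p + 1) / 4)) \<and>
         rat_cong p 2
           (\<Sum>k=0..(p - 1) div 2.
              of_nat ((4 * k choose (2 * k)) * (2 * k choose k)) / (of_nat (2 * k + 1) * 64 ^ k))
           (of_int (Legendre (- 1) (int p)) * 2 ^ (p - 1))"
proof -
  define n where "n = (p - 1) div 2"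
  have "odd p" using assms prime_odd_nat by auto
  then have n: "p = 2 * n + 1" by (auto simp: n_def elim: oddE)
  \<comment> \<open>Moves 2 k + 1 outermost, so that the summand becomes a \<open>bin_term\<close>
    value divided by 2 k + 1.\<close>
  have split: "a / (of_nat (2 * k + 1) * b) = a / b / of_nat (2 * k + 1)" for a b :: rat and k
    by (simp add: mult.commute)
  show ?thesis
    unfolding split bin_term_third bin_term_sixth bin_term_fourth atMost_atLeast0[symmetric]
      n_def[symmetric] bin_sum_def[symmetric] odd_bin_sum_def[symmetric]
    using bin_sum_third[OF assms n] odd_bin_sum_sixth[OF assms n] odd_bin_sum_fourth[OF assms n]
    by blast
qed

end
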